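(* Let $(r_n)$, $(s_n)$ be sequences of integers with $r_n\ge 2$, $s_n\ge 0$, $2r_n+s_n=n$, such that for every sufficiently large $n$ the double kite $DK(r_n,s_n)$ attains the minimum of $\operatorname{gap}(G)=\lambda_1(G)-\lambda_2(G)$ over all connected simple graphs $G$ on $n$ vertices. Then $r_n\sim \dfrac{n}{2\log n}$ as $n\to\infty$, i.e. $\lim_{n\to\infty} \dfrac{2 r_n\log n}{n}=1$.
   Context: For a finite simple undirected graph $G$, $\lambda_1(G)\ge\lambda_2(G)\ge\cdots$ denote the eigenvalues of its adjacency matrix, with multiplicity. For integers $r\ge 2$, $s\ge 0$, the double kite $DK(r,s)$ is the graph on $2r+s$ vertices formed from two vertex-disjoint copies of the complete graph $K_r$ and a path on $s+2$ vertices by identifying one endpoint of the path with a vertex of the first clique and the other endpoint with a vertex of the second clique. Logarithms are natural. *)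

theory Defs
  imports
    Complex_Main
    "HOL-Library.Landau_Symbols"
    "HOL-Computational_Algebra.Polynomial"
    "Graph_Theory.Pair_Digraph"
    "Graph_Theory.Digraph_Component"
    "Jordan_Normal_Form.Char_Poly"
begin

text \<open>
  A simple undirected graph is a finite symmetric loop-free digraph without parallel arcs
  (\<^locale>\<open>pair_graph\<close>). The \<open>n\<close> vertices are labelled \<open>0, \<dots>, n - 1\<close>, so every isomorphism
  class of graphs on \<open>n\<close> vertices is represented.
\<close>

definition connected_graph_on :: "nat \<Rightarrow> nat pair_pre_digraph \<Rightarrow> bool" where
  "connected_graph_on n G \<longleftrightarrow>
     pair_graph G \<and> pverts G = {..<n} \<and> Digraph_Component.connected (with_proj G)"

definition adjacency_matrix :: "nat pair_pre_digraph \<Rightarrow> real mat" where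
  "adjacency_matrix G =
     mat (card (pverts G)) (card (pverts G)) (\<lambda>(i, j). if (i, j) \<in> parcs G then 1 else 0)"

text \<open>
  The adjacency matrix is real symmetric, so all roots of its characteristic polynomial are real
  and algebraic and geometric multiplicities coincide. Indices start at \<open>1\<close>:
  \<open>graph_eigenvalue G k\<close> is the \<open>k\<close>-th largest eigenvalue, for \<open>1 \<le> k \<le> n\<close>.
\<close>

definition graph_eigenvalue :: "nat pair_pre_digraph \<Rightarrow> nat \<Rightarrow> real" where
  "graph_eigenvalue G k =
     rev (sorted_list_of_multiset (proots (char_poly (adjacency_matrix G)))) ! (k - 1)"

definition spectral_gap :: "nat pair_pre_digraph \<Rightarrow> real" where
  "spectral_gap G = graph_eigenvalue G 1 - graph_eigenvalue G 2"

text \<open>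
  The cliques are \<open>{0..r - 1}\<close> and \<open>{r + s..2 * r + s - 1}\<close>; the path is
  \<open>r - 1, r, \<dots>, r + s\<close>, which has \<open>s + 2\<close> vertices and shares the endpoint \<open>r - 1\<close> with the
  first clique and the endpoint \<open>r + s\<close> with the second.
\<close>

definition double_kite :: "nat \<Rightarrow> nat \<Rightarrow> nat pair_pre_digraph" where
  "double_kite r s =
     \<lparr> pverts = {..<2 * r + s},
       parcs = {(u, v). u \<noteq> v \<and> u \<in> {..<r} \<and> v \<in> {..<r}}
             \<union> {(u, v). u \<noteq> v \<and> u \<in> {r + s..<2 * r + s} \<and> v \<in> {r + s..<2 * r + s}}
             \<union> {(u, v). u \<in> {r - 1..r + s} \<and> v \<in> {r - 1..r + s} \<and> (v = Suc u \<or> u = Suc v)} \<rparr>"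

end

theory Submission
  imports Defs "HOL-Analysis.Convex" "HOL-Real_Asymp.Real_Asymp"
begin

text \<open>
  A graph minimising the gap among all connected graphs on \<open>n\<close> vertices minimises it in particular
  among the double kites on \<open>n\<close> vertices. So it is enough to know the gap of \<open>DK(r, s)\<close>, as a
  function of \<open>r\<close> with \<open>2 r + s = n\<close>, well enough on a logarithmic scale to locate its minimum.

  The two largest eigenvalues belong to an even and an odd eigenvector with respect to the exchange of
  the cliques. For \<open>r \<ge> 3\<close>, write an eigenvalue as \<open>x + 1 / x\<close>. Along the path the eigenvector is then a
  combination of \<open>x\<^sup>j\<close> and \<open>1 / x\<^sup>j\<close>, where \<open>r - 2 \<le> x \<le> r\<close>, so that the two eigenvectors, and with them
  the two eigenvalues, differ only through an overlap of relative size about \<open>1 / r\<^sup>s\<close>. Two bounds make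
  this precise:

  \<^item> \<open>spectral_gap_le\<close>: the gap is at most \<open>3 / (r - 2)\<^sup>s\<close>. The two eigenvalue equations at the
    junction of clique and path differ by that amount, and they depend on the eigenvalue with
    slope at least \<open>1\<close>.

  \<^item> \<open>spectral_gap_ge\<close>: the gap is at least \<open>1 / (72 n\<^sup>4 r\<^sup>s)\<close>. Dividing by the positive
    eigenvector \<open>v\<close> turns the gap into a weighted Dirichlet energy, and a Poincare inequality along the
    Hamiltonian path \<open>0, 1, \<dots>, n - 1\<close> of the double kite bounds this energy below by the smallest
    product \<open>v k * v (Suc k)\<close>, up to a power of \<open>n\<close>. The same inequality shows that the
    largest eigenvalue is a simple root of the characteristic polynomial, so that the second entry of
    the list of roots really is a different eigenvalue.

  A minimiser must therefore almost maximise \<open>(n - 2 r) ln r\<close>, up to an error \<open>o(n)\<close>; the competitor is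
  the clique size \<open>\<lfloor>n / (2 ln n)\<rfloor>\<close>, for which replacing \<open>r\<close> by \<open>r - 2\<close> costs only \<open>O(ln n)\<close>. With
  \<open>c = 2 r ln n / n\<close> the quantity to be maximised is
  \<open>n (ln n - ln (ln n) - ln 2 + ln c - c)\<close> up to lower order terms. As
  \<open>c - 1 - ln c \<ge> (sqrt c - 1)\<^sup>2\<close>, it is almost maximal only if \<open>c\<close> is close to \<open>1\<close>.
\<close>

section \<open>Nonnegative symmetric matrices with a positive eigenvector\<close>

lemma char_poly_root_iff:
  fixes a :: "nat \<Rightarrow> nat \<Rightarrow> 'a::field"
  shows "poly (char_poly (mat n n (\<lambda>(i, j). a i j))) l = 0 \<longleftrightarrow>
    (\<exists>u. (\<exists>k<n. u k \<noteq> 0) \<and> (\<forall>k<n. (\<Sum>j<n. a k j * u j) = l * u k))"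
proof -
  let ?A = "mat n n (\<lambda>(i, j). a i j)"
  have row: "(?A *\<^sub>v w) $ k = (\<Sum>j<n. a k j * w $ j)" if "k < n" "w \<in> carrier_vec n" for w k
    using that by (simp add: scalar_prod_def atLeast0LessThan)
  have "eigenvalue ?A l \<longleftrightarrow>
    (\<exists>u. (\<exists>k<n. u k \<noteq> 0) \<and> (\<forall>k<n. (\<Sum>j<n. a k j * u j) = l * u k))" (is "_ = ?R")
  proof
    assume "eigenvalue ?A l"
    then obtain w where w: "w \<in> carrier_vec n" "w \<noteq> 0\<^sub>v n" "?A *\<^sub>v w = l \<cdot>\<^sub>v w"
      by (auto simp: eigenvalue_def eigenvector_def)
    have "\<exists>k<n. w $ k \<noteq> 0" using w(1,2) by (metis eq_vecI carrier_vecD dim_vec index_zero_vec)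
    moreover have "(\<Sum>j<n. a k j * w $ j) = l * w $ k" if "k < n" for k
      using row[OF that w(1)] w that by simp
    ultimately show ?R by (intro exI[of _ "\<lambda>k. w $ k"]) blast
  next
    assume ?R
    then obtain u where u: "\<exists>k<n. u k \<noteq> 0" "\<forall>k<n. (\<Sum>j<n. a k j * u j) = l * u k" by blast
    have "eigenvector ?A (vec n u) l" unfolding eigenvector_def
    proof (intro conjI)
      show "vec n u \<noteq> 0\<^sub>v (dim_row ?A)" using u(1) by (metis dim_row_mat(1) index_vec index_zero_vec(1))
      show "?A *\<^sub>v vec n u = l \<cdot>\<^sub>v vec n u"
      proof (rule eq_vecI)
        fix k assume "k < dim_vec (l \<cdot>\<^sub>v vec n u)"
        then have k: "k < n" by simp
        have "(?A *\<^sub>v vec n u) $ k = (\<Sum>j<n. a k j * vec n u $ j)"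
          by (rule row[OF k]) simp
        also have "\<dots> = (\<Sum>j<n. a k j * u j)" by (rule sum.cong) auto
        also have "\<dots> = l * u k" using u(2) k by blast
        finally show "(?A *\<^sub>v vec n u) $ k = (l \<cdot>\<^sub>v vec n u) $ k" using k by simp
      qed simp
    qed simp
    then show "eigenvalue ?A l" unfolding eigenvalue_def by blast
  qed
  then show ?thesis by (subst eigenvalue_root_char_poly[symmetric, of _ n]) auto
qed

text \<open>
  Expanding the square leaves two sums in which one factor is a row sum \<open>\<Sum>j. a i j * v j\<close>, which the
  eigenvalue equation evaluates to \<open>m * v i\<close>; the mixed terms give the quadratic form of \<open>a\<close>.
  This is the ground state substitution \<open>u = g v\<close>.
\<close>
lemma dirichlet_form_identity:
  fixes a :: "nat \<Rightarrow> nat \<Rightarrow> real"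
  assumes sym: "\<And>i j. i < n \<Longrightarrow> j < n \<Longrightarrow> a i j = a j i"
    and v0: "\<And>k. k < n \<Longrightarrow> v k \<noteq> 0"
    and ev: "\<And>k. k < n \<Longrightarrow> (\<Sum>j<n. a k j * v j) = m * v k"
  shows "(\<Sum>i<n. \<Sum>j<n. a i j * (v i * v j) * (u i / v i - u j / v j)\<^sup>2)
    = 2 * (m * (\<Sum>k<n. (u k)\<^sup>2) - (\<Sum>k<n. u k * (\<Sum>j<n. a k j * u j)))"
proof -
  have t: "a i j * (v i * v j) * (u i / v i - u j / v j)\<^sup>2 =
     (u i)\<^sup>2 / v i * (a i j * v j) + (u j)\<^sup>2 / v j * (a j i * v i) - 2 * (u i * (a i j * u j))"
    if "i < n" "j < n" for i j
    using v0[OF that(1)] v0[OF that(2)] sym[OF that]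
    by (simp add: field_simps power2_eq_square)
  have s: "(\<Sum>i<n. \<Sum>j<n. (u i)\<^sup>2 / v i * (a i j * v j)) = m * (\<Sum>k<n. (u k)\<^sup>2)"
  proof -
    have "(\<Sum>j<n. (u i)\<^sup>2 / v i * (a i j * v j)) = m * (u i)\<^sup>2" if "i < n" for i
      unfolding sum_distrib_left[symmetric] ev[OF that] using v0[OF that] by simp
    then show ?thesis unfolding sum_distrib_left[of m] by (intro sum.cong) auto
  qed
  have "(\<Sum>i<n. \<Sum>j<n. a i j * (v i * v j) * (u i / v i - u j / v j)\<^sup>2) =
     (\<Sum>i<n. \<Sum>j<n. (u i)\<^sup>2 / v i * (a i j * v j)) + (\<Sum>i<n. \<Sum>j<n. (u j)\<^sup>2 / v j * (a j i * v i))
     - 2 * (\<Sum>i<n. \<Sum>j<n. u i * (a i j * u j))"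
    unfolding sum.distrib[symmetric] sum_subtractf[symmetric] sum_distrib_left
    by (intro sum.cong refl) (simp add: t sum_distrib_left)
  also have "(\<Sum>i<n. \<Sum>j<n. (u j)\<^sup>2 / v j * (a j i * v i)) = (\<Sum>i<n. \<Sum>j<n. (u i)\<^sup>2 / v i * (a i j * v j))"
    by (rule sum.swap)
  finally have "(\<Sum>i<n. \<Sum>j<n. a i j * (v i * v j) * (u i / v i - u j / v j)\<^sup>2) =
     2 * (m * (\<Sum>k<n. (u k)\<^sup>2)) - 2 * (\<Sum>i<n. \<Sum>j<n. u i * (a i j * u j))" unfolding s by simp
  then show ?thesis unfolding sum_distrib_left[symmetric] by (simp add: right_diff_distrib)
qed

text \<open>
  The sign condition forces the quotient \<open>g = u / v\<close> to vary along the path by at least its largest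
  absolute value. Cauchy-Schwarz then bounds the largest value by the energy of \<open>g\<close>, at the cost of
  a power of \<open>n\<close> that is harmless next to the exponential size of the gap. The condition holds both for
  vectors orthogonal to \<open>v\<close> and for vectors with a zero entry; the former give the gap,
  the latter the simplicity of the largest eigenvalue.
\<close>
lemma poincare_along_path:
  fixes a :: "nat \<Rightarrow> nat \<Rightarrow> real"
  assumes sym: "\<And>i j. i < n \<Longrightarrow> j < n \<Longrightarrow> a i j = a j i"
    and nonneg: "\<And>i j. i < n \<Longrightarrow> j < n \<Longrightarrow> 0 \<le> a i j"
    and path: "\<And>k. Suc k < n \<Longrightarrow> 1 \<le> a k (Suc k)"
    and v: "\<And>k. k < n \<Longrightarrow> 0 < v k" "\<And>k. k < n \<Longrightarrow> v k \<le> M"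
    and p: "0 < p" "\<And>k. Suc k < n \<Longrightarrow> p \<le> v k * v (Suc k)"
    and ev: "\<And>k. k < n \<Longrightarrow> (\<Sum>j<n. a k j * v j) = m * v k"
    and sgn: "\<And>i. i < n \<Longrightarrow> \<exists>j<n. u i * u j \<le> 0"
  shows "p / (2 * M\<^sup>2 * (real n)\<^sup>2) * (\<Sum>k<n. (u k)\<^sup>2)
    \<le> m * (\<Sum>k<n. (u k)\<^sup>2) - (\<Sum>k<n. u k * (\<Sum>j<n. a k j * u j))"
proof (cases "n = 0")
  case False
  define g where "g k = u k / v k" for k
  define D where "D = (\<Sum>k<n-1. \<bar>g (Suc k) - g k\<bar>)"
  define E where "E = (\<Sum>k<n-1. (g (Suc k) - g k)\<^sup>2)"
  have M: "0 < M" using v False by force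
  have D_le: "\<bar>g j - g i\<bar> \<le> D" if "i \<le> j" "j < n" for i j
  proof -
    have "g j - g i = (\<Sum>k\<in>{i..<j}. g (Suc k) - g k)" using that by (simp add: sum_Suc_diff')
    also have "\<bar>\<dots>\<bar> \<le> (\<Sum>k\<in>{i..<j}. \<bar>g (Suc k) - g k\<bar>)" by (rule sum_abs)
    also have "\<dots> \<le> D" unfolding D_def by (rule sum_mono2) (use that in auto)
    finally show ?thesis .
  qed
  have g_le: "(g i)\<^sup>2 \<le> D\<^sup>2" if i: "i < n" for i
  proof -
    obtain j where j: "j < n" "u i * u j \<le> 0" using sgn[OF i] by blast
    have gg: "g i * g j \<le> 0" using j v(1)[OF i] v(1)[OF j(1)]
      by (simp add: g_def divide_le_0_iff)
    have "\<bar>g i - g j\<bar> \<le> D"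
      using D_le[of i j] D_le[of j i] i j by (cases "i \<le> j") (auto simp: abs_minus_commute)
    moreover have "\<bar>g i\<bar> \<le> \<bar>g i - g j\<bar>" using gg by (auto simp: mult_le_0_iff)
    ultimately have "\<bar>g i\<bar> \<le> D" by simp
    then show ?thesis by (metis abs_ge_zero power2_abs power_mono)
  qed
  have CS: "D\<^sup>2 \<le> real n * E"
  proof -
    have "D\<^sup>2 \<le> real (card {..<n-1}) * (\<Sum>k<n-1. \<bar>g (Suc k) - g k\<bar>\<^sup>2)"
      unfolding D_def using sum_squared_le_sum_of_squares[of "\<lambda>k. \<bar>g (Suc k) - g k\<bar>" "{..<n-1}"]
      by (simp add: mult.commute)
    also have "\<dots> \<le> real n * E" unfolding E_def
      by (auto intro!: mult_right_mono sum_nonneg)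
    finally show ?thesis .
  qed
  have "(\<Sum>k<n. (u k)\<^sup>2) \<le> (\<Sum>k<n. D\<^sup>2 * M\<^sup>2)"
  proof (rule sum_mono)
    fix k assume "k \<in> {..<n}"
    then have k: "k < n" by simp
    have "(u k)\<^sup>2 = (g k)\<^sup>2 * (v k)\<^sup>2"
      using v(1)[OF k] by (simp add: g_def field_simps)
    also have "\<dots> \<le> D\<^sup>2 * M\<^sup>2" 
      by (intro mult_mono g_le k power_mono v) (use v(1)[OF k] in auto)
    finally show "(u k)\<^sup>2 \<le> D\<^sup>2 * M\<^sup>2" .
  qed
  also have "\<dots> \<le> real n * ((real n * E) * M\<^sup>2)"
    by (simp, intro mult_mono CS) (auto simp: E_def sum_nonneg)
  finally have U: "(\<Sum>k<n. (u k)\<^sup>2) \<le> (real n)\<^sup>2 * M\<^sup>2 * E" by (simp add: power2_eq_square mult_ac)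
  have "p * E \<le> (\<Sum>k<n-1. a k (Suc k) * (v k * v (Suc k)) * (u k / v k - u (Suc k) / v (Suc k))\<^sup>2)"
    unfolding E_def sum_distrib_left
  proof (rule sum_mono)
    fix k assume "k \<in> {..<n-1}"
    then have k: "Suc k < n" by auto
    have "p * (g (Suc k) - g k)\<^sup>2 \<le> (1 * (v k * v (Suc k))) * (g (Suc k) - g k)\<^sup>2"
      using p(2)[OF k] by (intro mult_right_mono) auto
    also have "\<dots> \<le> (a k (Suc k) * (v k * v (Suc k))) * (g (Suc k) - g k)\<^sup>2"
      using path[OF k] v(1)[of k] v(1)[of "Suc k"] k by (intro mult_right_mono) auto
    finally show "p * (g (Suc k) - g k)\<^sup>2 \<le> a k (Suc k) * (v k * v (Suc k)) * (u k / v k - u (Suc k) / v (Suc k))\<^sup>2"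
      by (simp add: g_def power2_commute)
  qed
  also have "\<dots> \<le> (\<Sum>k<n-1. \<Sum>j<n. a k j * (v k * v j) * (u k / v k - u j / v j)\<^sup>2)"
  proof (rule sum_mono)
    fix k assume "k \<in> {..<n-1}"
    then have k: "Suc k < n" by auto
    have nn: "0 \<le> a k j * (v k * v j) * (u k / v k - u j / v j)\<^sup>2" if "j < n" for j
      using nonneg[of k j] that k v(1)[of k] v(1)[OF that] by auto
    show "a k (Suc k) * (v k * v (Suc k)) * (u k / v k - u (Suc k) / v (Suc k))\<^sup>2 \<le>
      (\<Sum>j<n. a k j * (v k * v j) * (u k / v k - u j / v j)\<^sup>2)"
      by (rule member_le_sum[of "Suc k" "{..<n}" "\<lambda>j. a k j * (v k * v j) * (u k / v k - u j / v j)\<^sup>2"])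
         (use k nn in auto)
  qed
  also have "\<dots> \<le> (\<Sum>k<n. \<Sum>j<n. a k j * (v k * v j) * (u k / v k - u j / v j)\<^sup>2)"
  proof (rule sum_mono2)
    fix k assume "k \<in> {..<n} - {..<n-1}"
    then have k: "k < n" by simp
    show "0 \<le> (\<Sum>j<n. a k j * (v k * v j) * (u k / v k - u j / v j)\<^sup>2)"
      by (intro sum_nonneg mult_nonneg_nonneg nonneg k) (use v(1) k less_imp_le in auto)
  qed auto
  also have "\<dots> = 2 * (m * (\<Sum>k<n. (u k)\<^sup>2) - (\<Sum>k<n. u k * (\<Sum>j<n. a k j * u j)))"
    by (rule dirichlet_form_identity[OF sym _ ev]) (use v(1) in \<open>auto simp: less_le\<close>)
  finally have pE: "p * E \<le> 2 * (m * (\<Sum>k<n. (u k)\<^sup>2) - (\<Sum>k<n. u k * (\<Sum>j<n. a k j * u j)))" .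
  have "p / (2 * M\<^sup>2 * (real n)\<^sup>2) * (\<Sum>k<n. (u k)\<^sup>2) \<le> p / (2 * M\<^sup>2 * (real n)\<^sup>2) * ((real n)\<^sup>2 * M\<^sup>2 * E)"
    using U p(1) by (intro mult_left_mono) auto
  also have "\<dots> = p * E / 2" using M False by (simp add: field_simps)
  also have "\<dots> \<le> m * (\<Sum>k<n. (u k)\<^sup>2) - (\<Sum>k<n. u k * (\<Sum>j<n. a k j * u j))"
    using pE by (simp only: pos_divide_le_eq[of "2::real"] mult.commute[of _ "2::real"])
  finally show ?thesis .
qed simp

text \<open>
  Evaluate the eigenvalue equation for \<open>u\<close> at an index where \<open>\<bar>u\<bar> / v\<close> is largest.
\<close>
lemma perron_bound:
  fixes a :: "nat \<Rightarrow> nat \<Rightarrow> real"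
  assumes nonneg: "\<And>i j. i < n \<Longrightarrow> j < n \<Longrightarrow> 0 \<le> a i j"
    and v: "\<And>k. k < n \<Longrightarrow> 0 < v k"
    and ev: "\<And>k. k < n \<Longrightarrow> (\<Sum>j<n. a k j * v j) = m * v k"
    and root: "poly (char_poly (mat n n (\<lambda>(i, j). a i j))) l = 0"
  shows "l \<le> m"
proof -
  obtain u where u: "\<exists>k<n. u k \<noteq> 0" "\<And>k. k < n \<Longrightarrow> (\<Sum>j<n. a k j * u j) = l * u k"
    using root unfolding char_poly_root_iff by blast
  define g where "g k = \<bar>u k\<bar> / v k" for k
  have ne: "{..<n} \<noteq> {}" using u(1) by auto
  obtain i where i: "i < n" "\<And>k. k < n \<Longrightarrow> g k \<le> g i"
  proof -
    have "Max (g ` {..<n}) \<in> g ` {..<n}" using ne by (intro Max_in) auto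
    then obtain i where "i < n" "Max (g ` {..<n}) = g i" by auto
    moreover have "g k \<le> Max (g ` {..<n})" if "k < n" for k using that by (intro Max_ge) auto
    ultimately show ?thesis using that[of i] by auto
  qed
  have abs_le: "\<bar>u j\<bar> \<le> g i * v j" if "j < n" for j
    using i(2)[OF that] v[OF that] by (simp add: g_def field_simps)
  obtain k where k: "k < n" "u k \<noteq> 0" using u(1) by blast
  have "0 < g k" using k v[OF k(1)] by (simp add: g_def)
  then have gi: "0 < g i" using i(2)[OF k(1)] by simp
  have "\<bar>l\<bar> * (g i * v i) = \<bar>\<Sum>j<n. a i j * u j\<bar>"
    using v[OF i(1)] by (simp add: u(2)[OF i(1)] abs_mult g_def)
  also have "\<dots> \<le> (\<Sum>j<n. a i j * (g i * v j))"
    by (rule order_trans[OF sum_abs sum_mono]) (use nonneg i abs_le in \<open>auto simp: abs_mult intro!: mult_left_mono\<close>)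
  also have "\<dots> = g i * (\<Sum>j<n. a i j * v j)" by (simp add: sum_distrib_left mult_ac)
  also have "\<dots> = m * (g i * v i)" using ev[OF i(1)] by simp
  finally show "l \<le> m" using gi v[OF i(1)] 
    by (smt (verit) mult_pos_pos mult_right_le_imp_le)
qed

lemma monic_pos_above_roots:
  fixes q :: "real poly"
  assumes "monic q" "\<And>x. m \<le> x \<Longrightarrow> poly q x \<noteq> 0"
  shows "0 < poly q m"
proof (rule ccontr)
  assume "\<not> 0 < poly q m"
  with assms(2)[of m] have neg: "poly q m < 0" by force
  obtain x where x: "m < x" "0 < poly q x"
  proof -
    have "\<exists>N. \<forall>x\<ge>N. 1 \<le> poly q x"
      using poly_pinfty_gt_lc[of q] assms(1) by auto
    then obtain N where "\<forall>x\<ge>N. 1 \<le> poly q x" by blast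
    then show ?thesis using that[of "max N (m + 1)"] by (smt (verit) max.cobounded1 max.cobounded2)
  qed
  then show False using poly_IVT_pos[OF x(1) neg x(2)] assms(2) by (metis less_imp_le)
qed

text \<open>
  The derivative of the characteristic polynomial is, up to the factor \<open>x\<close>, the sum of the
  characteristic polynomials of the matrices with one row and the same column erased. An
  eigenvector of such a matrix for a nonzero eigenvalue vanishes at the erased index, so the
  Poincare inequality keeps that eigenvalue strictly below \<open>m\<close>. Hence all summands are positive at \<open>m\<close> and
  the derivative does not vanish there.
\<close>
lemma perron_root_simple:
  fixes a :: "nat \<Rightarrow> nat \<Rightarrow> real"
  assumes sym: "\<And>i j. i < n \<Longrightarrow> j < n \<Longrightarrow> a i j = a j i"
    and nonneg: "\<And>i j. i < n \<Longrightarrow> j < n \<Longrightarrow> 0 \<le> a i j"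
    and path: "\<And>k. Suc k < n \<Longrightarrow> 1 \<le> a k (Suc k)"
    and v: "\<And>k. k < n \<Longrightarrow> 0 < v k" "\<And>k. k < n \<Longrightarrow> v k \<le> M"
    and p: "0 < p" "\<And>k. Suc k < n \<Longrightarrow> p \<le> v k * v (Suc k)"
    and ev: "\<And>k. k < n \<Longrightarrow> (\<Sum>j<n. a k j * v j) = m * v k"
    and n: "0 < n" and m: "0 < m"
  shows "order m (char_poly (mat n n (\<lambda>(i, j). a i j))) = 1"
proof -
  let ?A = "mat n n (\<lambda>(i, j). a i j)"
  have A: "?A \<in> carrier_mat n n" by simp
  have minor: "0 < poly (char_poly (mat_erase ?A i i)) m" if i: "i < n" for i
  proof (rule monic_pos_above_roots)
    show "monic (char_poly (mat_erase ?A i i))"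
      using degree_monic_char_poly[of "mat_erase ?A i i" n] by simp
    fix x assume x: "m \<le> x"
    show "poly (char_poly (mat_erase ?A i i)) x \<noteq> 0"
    proof
      assume root: "poly (char_poly (mat_erase ?A i i)) x = 0"
      define b where "b k j = (if k = i \<or> j = i then 0 else a k j)" for k j
      have "mat_erase ?A i i = mat n n (\<lambda>(k, j). b k j)"
        by (rule eq_matI) (auto simp: mat_erase_def b_def)
      then obtain u where u: "\<exists>k<n. u k \<noteq> 0" "\<And>k. k < n \<Longrightarrow> (\<Sum>j<n. b k j * u j) = x * u k"
        using root by (metis char_poly_root_iff)
      have ui: "u i = 0" using u(2)[OF i] m x by (simp add: b_def)
      have row: "u k * (\<Sum>j<n. a k j * u j) = x * (u k)\<^sup>2" if "k < n" for k
      proof (cases "k = i")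
        case False
        have "(\<Sum>j<n. a k j * u j) = (\<Sum>j<n. b k j * u j)"
          by (rule sum.cong) (use ui False in \<open>auto simp: b_def\<close>)
        then show ?thesis using u(2)[OF that] by (simp add: power2_eq_square)
      qed (simp add: ui)
      have S: "0 < (\<Sum>k<n. (u k)\<^sup>2)"
        using u(1) by (auto intro!: sum_pos2)
      have "p / (2 * M\<^sup>2 * (real n)\<^sup>2) * (\<Sum>k<n. (u k)\<^sup>2)
        \<le> m * (\<Sum>k<n. (u k)\<^sup>2) - (\<Sum>k<n. u k * (\<Sum>j<n. a k j * u j))"
        by (rule poincare_along_path[OF sym nonneg path v p ev]) (use ui i in auto)
      also have "(\<Sum>k<n. u k * (\<Sum>j<n. a k j * u j)) = x * (\<Sum>k<n. (u k)\<^sup>2)"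
        unfolding sum_distrib_left[of x] by (intro sum.cong) (auto simp: row)
      also have "m * (\<Sum>k<n. (u k)\<^sup>2) - x * (\<Sum>k<n. (u k)\<^sup>2) \<le> 0"
        using x S by (simp add: mult_right_mono)
      finally have "p / (2 * M\<^sup>2 * (real n)\<^sup>2) \<le> 0" using S by (metis mult_le_0_iff not_le)
      moreover have "0 < M" using v[OF n] by simp
      then have "0 < p / (2 * M\<^sup>2 * (real n)\<^sup>2)" using p(1) n by simp
      ultimately show False by simp
    qed
  qed
  let ?q = "char_poly ?A"
  have "m * poly (pderiv ?q) m = (\<Sum>i<n. poly (char_poly (mat_erase ?A i i)) m)"
    using arg_cong[OF pderiv_char_poly_mat_erase[OF A], of "\<lambda>q. poly q m"]
    by (simp add: poly_monom poly_sum)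
  also have "\<dots> > 0" using n by (intro sum_pos minor) auto
  finally have d: "poly (pderiv ?q) m \<noteq> 0" by auto
  have q0: "?q \<noteq> 0" using d by auto
  have root: "poly ?q m = 0" unfolding char_poly_root_iff using v(1) ev n
    by (intro exI[of _ v]) force
  have "order m ?q = Suc (order m (pderiv ?q))"
    by (rule order_pderiv[OF q0 root])
  then show ?thesis using d by (simp add: order_0I)
qed

section \<open>The two largest eigenvalues of a graph\<close>

lemma graph_eigenvalue_1_eq:
  assumes "poly (char_poly (adjacency_matrix G)) m = 0"
    and "\<And>l. poly (char_poly (adjacency_matrix G)) l = 0 \<Longrightarrow> l \<le> m"
    and q0: "char_poly (adjacency_matrix G) \<noteq> 0"
  shows "graph_eigenvalue G 1 = m"
proof -
  define xs where "xs = rev (sorted_list_of_multiset (proots (char_poly (adjacency_matrix G))))"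
  have set_xs: "set xs = {l. poly (char_poly (adjacency_matrix G)) l = 0}"
    using q0 by (simp add: xs_def)
  have srt: "sorted_wrt (\<ge>) xs" by (simp add: xs_def sorted_wrt_rev)
  obtain x ys where xs: "xs = x # ys" using assms(1) set_xs by (cases xs) auto
  have "m \<le> x" using srt assms(1) set_xs xs by auto
  moreover have "x \<le> m" using assms(2) set_xs xs by auto
  ultimately show ?thesis unfolding graph_eigenvalue_def xs_def[symmetric] using xs by simp
qed

lemma graph_eigenvalue_2_ge:
  assumes "poly (char_poly (adjacency_matrix G)) m = 0" "poly (char_poly (adjacency_matrix G)) l = 0"
    and "l < m" and q0: "char_poly (adjacency_matrix G) \<noteq> 0"
  shows "l \<le> graph_eigenvalue G 2"
proof -
  define xs where "xs = rev (sorted_list_of_multiset (proots (char_poly (adjacency_matrix G))))"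
  have set_xs: "set xs = {l. poly (char_poly (adjacency_matrix G)) l = 0}"
    using q0 by (simp add: xs_def)
  have srt: "sorted_wrt (\<ge>) xs" by (simp add: xs_def sorted_wrt_rev)
  have mem: "m \<in> set xs" "l \<in> set xs" using assms set_xs by auto
  obtain x y ys where xs: "xs = x # y # ys"
    using mem \<open>l < m\<close> by (cases xs; cases "tl xs") auto
  have "l \<le> y" using srt mem \<open>l < m\<close> xs by auto
  then show ?thesis unfolding graph_eigenvalue_def xs_def[symmetric] using xs by simp
qed

text \<open>
  A second root is required because the list contains only the real roots: without it the list could
  consist of \<open>m\<close> alone, and indexing its second entry would give an unspecified value.
\<close>
lemma graph_eigenvalue_2_other:
  assumes ord: "order m (char_poly (adjacency_matrix G)) = 1"
    and m: "\<And>l. poly (char_poly (adjacency_matrix G)) l = 0 \<Longrightarrow> l \<le> m"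
    and other: "poly (char_poly (adjacency_matrix G)) l = 0" "l \<noteq> m"
    and q0: "char_poly (adjacency_matrix G) \<noteq> 0"
  shows "poly (char_poly (adjacency_matrix G)) (graph_eigenvalue G 2) = 0
    \<and> graph_eigenvalue G 2 \<noteq> m"
proof -
  define R where "R = proots (char_poly (adjacency_matrix G))"
  define xs where "xs = rev (sorted_list_of_multiset R)"
  have set_xs: "set xs = {l. poly (char_poly (adjacency_matrix G)) l = 0}"
    using q0 by (simp add: xs_def R_def)
  have srt: "sorted_wrt (\<ge>) xs" by (simp add: xs_def sorted_wrt_rev)
  have "count (mset xs) m = 1" using ord q0 by (simp add: xs_def R_def)
  then have cnt: "length (filter ((=) m) xs) = 1"
    by (simp add: count_mset count_list_eq_length_filter)
  have mem: "l \<in> set xs" "m \<in> set xs"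
    using other set_xs ord order_root[of "char_poly (adjacency_matrix G)" m] by auto
  obtain x y ys where xs: "xs = x # y # ys"
    using mem other(2) by (cases xs; cases "tl xs") auto
  have "x = m" using srt mem(2) m set_xs xs by (auto intro: antisym)
  then have "y \<noteq> m" using cnt xs by auto
  moreover have "y \<in> set xs" using xs by simp
  moreover have "graph_eigenvalue G 2 = y"
    unfolding graph_eigenvalue_def R_def[symmetric] xs_def[symmetric] using xs by simp
  ultimately show ?thesis using set_xs by simp
qed

definition adj :: "nat pair_pre_digraph \<Rightarrow> nat \<Rightarrow> nat \<Rightarrow> real" where
  "adj G i j = (if (i, j) \<in> parcs G then 1 else 0)"

lemma adjacency_matrix_eq: "card (pverts G) = n \<Longrightarrow> adjacency_matrix G = mat n n (\<lambda>(i, j). adj G i j)"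
  by (simp add: adjacency_matrix_def adj_def)

lemma pverts_double_kite [simp]:
  "pverts (double_kite r s) = {..<2 * r + s}" by (simp add: double_kite_def)

lemma double_kite_adjacency:
  "adjacency_matrix (double_kite r s) = mat (2 * r + s) (2 * r + s) (\<lambda>(i, j). adj (double_kite r s) i j)"
  by (rule adjacency_matrix_eq) simp

lemma double_kite_char_poly_nonzero: "char_poly (adjacency_matrix (double_kite r s)) \<noteq> 0"
  using degree_monic_char_poly[of "adjacency_matrix (double_kite r s)" "2 * r + s"]
  by (auto simp: double_kite_adjacency)

lemma double_kite_sym: "adj (double_kite r s) i j = adj (double_kite r s) j i"
  by (auto simp: adj_def double_kite_def)

text \<open>
  The labels \<open>0, 1, \<dots>, 2 r + s - 1\<close> thus run along a Hamiltonian path, which serves both for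
  connectedness and for the Poincare inequality.
\<close>
lemma double_kite_consecutive:
  assumes "2 \<le> r" "Suc k < 2 * r + s"
  shows "(k, Suc k) \<in> parcs (double_kite r s)"
  using assms by (auto simp: double_kite_def)

text \<open>
  The second eigenvalue is a root different from \<open>m\<close>, so it has an eigenvector \<open>u\<close> orthogonal to
  \<open>v\<close> by symmetry. As \<open>v\<close> is positive, \<open>u\<close> changes sign and the Poincare inequality applies.
\<close>
lemma spectral_gap_ge_if_positive_eigenvector:
  assumes r: "2 \<le> r" and n: "n = 2 * r + s"
    and v: "\<And>k. k < n \<Longrightarrow> 0 < v k" "\<And>k. k < n \<Longrightarrow> v k \<le> M"
    and p: "0 < p" "\<And>k. Suc k < n \<Longrightarrow> p \<le> v k * v (Suc k)"
    and ev: "\<And>k. k < n \<Longrightarrow> (\<Sum>j<n. adj (double_kite r s) k j * v j) = m * v k"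
    and m: "0 < m"
    and other: "poly (char_poly (adjacency_matrix (double_kite r s))) l = 0" "l \<noteq> m"
  shows "p / (2 * M\<^sup>2 * (real n)\<^sup>2) \<le> spectral_gap (double_kite r s)"
proof -
  define G where "G = double_kite r s"
  define a where "a = adj G"
  have sym: "\<And>i j. i < n \<Longrightarrow> j < n \<Longrightarrow> a i j = a j i"
    using double_kite_sym by (simp add: a_def G_def)
  have nonneg: "\<And>i j. i < n \<Longrightarrow> j < n \<Longrightarrow> 0 \<le> a i j" by (simp add: a_def adj_def)
  have path: "\<And>k. Suc k < n \<Longrightarrow> 1 \<le> a k (Suc k)"
    using double_kite_consecutive[OF r] n by (simp add: a_def adj_def G_def)
  have ev': "\<And>k. k < n \<Longrightarrow> (\<Sum>j<n. a k j * v j) = m * v k" using ev by (simp add: a_def G_def)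
  have n0: "0 < n" using r n by simp
  have A: "adjacency_matrix G = mat n n (\<lambda>(i, j). a i j)"
    unfolding G_def a_def n by (rule double_kite_adjacency)
  have q0: "char_poly (adjacency_matrix G) \<noteq> 0"
    unfolding G_def by (rule double_kite_char_poly_nonzero)
  have top: "\<And>l. poly (char_poly (adjacency_matrix G)) l = 0 \<Longrightarrow> l \<le> m"
    unfolding A by (rule perron_bound[OF nonneg v(1) ev'])
  have ord: "order m (char_poly (adjacency_matrix G)) = 1"
    unfolding A by (rule perron_root_simple[OF sym nonneg path v p ev' n0 m])
  then have root: "poly (char_poly (adjacency_matrix G)) m = 0" using order_root by force
  define l2 where "l2 = graph_eigenvalue G 2"
  have l2: "poly (char_poly (adjacency_matrix G)) l2 = 0" "l2 \<noteq> m"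
    using graph_eigenvalue_2_other[OF ord top other(1)[folded G_def] other(2) q0] by (auto simp: l2_def)
  have gap: "spectral_gap G = m - l2"
    using graph_eigenvalue_1_eq[OF root top q0] by (simp add: spectral_gap_def l2_def)
  obtain u where u: "\<exists>k<n. u k \<noteq> 0" "\<And>k. k < n \<Longrightarrow> (\<Sum>j<n. a k j * u j) = l2 * u k"
    using l2(1) unfolding A char_poly_root_iff by blast
  have "m * (\<Sum>k<n. u k * v k) = (\<Sum>k<n. u k * (\<Sum>j<n. a k j * v j))"
    unfolding sum_distrib_left[of m] by (intro sum.cong) (auto simp: ev')
  also have "\<dots> = (\<Sum>k<n. \<Sum>j<n. v j * (a j k * u k))"
    unfolding sum_distrib_left by (intro sum.cong refl) (use sym in \<open>simp add: mult_ac\<close>)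
  also have "\<dots> = (\<Sum>j<n. v j * (\<Sum>k<n. a j k * u k))"
    unfolding sum_distrib_left by (rule sum.swap)
  also have "\<dots> = l2 * (\<Sum>k<n. u k * v k)"
    unfolding sum_distrib_left[of l2] by (intro sum.cong) (auto simp: u(2))
  finally have orth: "(\<Sum>k<n. u k * v k) = 0" using l2(2) by simp
  have sgn: "\<exists>j<n. u i * u j \<le> 0" if "i < n" for i
  proof (rule ccontr)
    assume "\<not> ?thesis"
    then have "0 < u i * u j" if "j < n" for j using that by force
    then have "0 < (\<Sum>j<n. u i * u j * v j)"
      using n0 v(1) by (intro sum_pos) auto
    also have "\<dots> = u i * (\<Sum>j<n. u j * v j)" by (simp add: sum_distrib_left mult_ac)
    finally show False using orth by simp
  qed
  have S: "0 < (\<Sum>k<n. (u k)\<^sup>2)" using u(1) by (auto intro!: sum_pos2)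
  have "p / (2 * M\<^sup>2 * (real n)\<^sup>2) * (\<Sum>k<n. (u k)\<^sup>2)
    \<le> m * (\<Sum>k<n. (u k)\<^sup>2) - (\<Sum>k<n. u k * (\<Sum>j<n. a k j * u j))"
    by (rule poincare_along_path[OF sym nonneg path v p ev' sgn])
  also have "(\<Sum>k<n. u k * (\<Sum>j<n. a k j * u j)) = l2 * (\<Sum>k<n. (u k)\<^sup>2)"
    unfolding sum_distrib_left[of l2] by (intro sum.cong) (auto simp: u(2) power2_eq_square)
  finally have "p / (2 * M\<^sup>2 * (real n)\<^sup>2) * (\<Sum>k<n. (u k)\<^sup>2) \<le> (m - l2) * (\<Sum>k<n. (u k)\<^sup>2)"
    by (simp add: left_diff_distrib)
  then show ?thesis using S gap unfolding G_def[symmetric] by (metis mult_right_le_imp_le)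
qed

text \<open>
  The function \<open>f\<close> gives the entries on the path, counted from the first junction. For \<open>e = 1\<close> and
  \<open>e = - 1\<close> the vector is even and odd under the exchange of the two cliques.
\<close>
definition kite_vec :: "nat \<Rightarrow> nat \<Rightarrow> real \<Rightarrow> real \<Rightarrow> (nat \<Rightarrow> real) \<Rightarrow> nat \<Rightarrow> real" where
  "kite_vec r s e c f k =
     (if k < r - 1 then c else if k \<le> r + s then f (k - (r - 1)) else e * c)"

lemma kite_vec_eigen:
  assumes r: "2 \<le> r"
    and sym: "\<And>j. j \<le> Suc s \<Longrightarrow> f (Suc s - j) = e * f j" and e: "e * e = 1"
    and path: "\<And>j. 1 \<le> j \<Longrightarrow> j \<le> s \<Longrightarrow> l * f j = f (j - 1) + f (j + 1)"
    and clique: "(l - real r + 2) * c = f 0"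
    and junction: "l * f 0 = (real r - 1) * c + f 1"
    and k: "k < 2 * r + s"
  shows "(\<Sum>j<2 * r + s. adj (double_kite r s) k j * kite_vec r s e c f j) = l * kite_vec r s e c f k"
proof -
  let ?v = "kite_vec r s e c f" and ?n = "2 * r + s"
  define N where "N = {j. (k, j) \<in> parcs (double_kite r s)}"
  have N_sub: "N \<subseteq> {..<?n}" using r by (auto simp: N_def double_kite_def)
  have "(\<Sum>j<?n. adj (double_kite r s) k j * ?v j) = (\<Sum>j<?n. if j \<in> N then ?v j else 0)"
    by (intro sum.cong) (auto simp: adj_def N_def)
  also have "\<dots> = sum ?v N"
    using N_sub by (simp add: sum.If_cases Int_absorb1)
  finally have eq: "(\<Sum>j<?n. adj (double_kite r s) k j * ?v j) = sum ?v N" .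
  have c1: "sum ?v {..<r-1} = (real r - 1) * c"
    using r by (simp add: kite_vec_def of_nat_diff)
  have c2: "sum ?v {r+s+1..<?n} = (real r - 1) * (e * c)"
  proof -
    have "sum ?v {r+s+1..<?n} = (\<Sum>j\<in>{r+s+1..<?n}. e * c)"
      by (intro sum.cong) (auto simp: kite_vec_def)
    then show ?thesis using r by (simp add: of_nat_diff)
  qed
  have v1: "?v (r - 1) = f 0" and v2: "?v (r + s) = e * f 0" and v3: "?v r = f 1"
    and v4: "?v (r + s - 1) = e * f 1"
    using r sym[of 0] sym[of 1] by (auto simp: kite_vec_def)
  consider "k < r - 1" | "k = r - 1" | "r - 1 < k" "k < r + s" | "k = r + s" | "r + s < k" by linarith
  then show ?thesis
  proof cases
    case 1
    have N: "N = insert (r - 1) {..<r-1} - {k}" using 1 r by (auto simp: N_def double_kite_def)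
    have "sum ?v N = f 0 + (real r - 1) * c - c"
      unfolding N using 1 c1 v1 by (subst sum_diff1) (auto simp: kite_vec_def)
    moreover have "?v k = c" using 1 by (simp add: kite_vec_def)
    ultimately show ?thesis using clique unfolding eq by (simp add: algebra_simps)
  next
    case 2
    have N: "N = insert r {..<r-1}" using 2 r by (auto simp: N_def double_kite_def)
    have "sum ?v N = f 1 + (real r - 1) * c"
      unfolding N using r c1 v3 by (subst sum.insert) auto
    then show ?thesis unfolding eq using 2 junction v1 by simp
  next
    case 3
    have N: "N = {k - 1, k + 1}" using 3 r by (auto simp: N_def double_kite_def)
    define j where "j = k - (r - 1)"
    have j: "1 \<le> j" "j \<le> s" "k = j + (r - 1)" using 3 r by (auto simp: j_def)
    have "sum ?v N = f (j - 1) + f (j + 1)"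
      unfolding N using j r by (auto simp: kite_vec_def)
    then show ?thesis using path[OF j(1,2)] 3 r j(3) unfolding eq by (simp add: kite_vec_def)
  next
    case 4
    have N: "N = insert (r + s - 1) {r+s+1..<?n}" using 4 r by (auto simp: N_def double_kite_def)
    have "sum ?v N = e * f 1 + (real r - 1) * (e * c)"
      unfolding N using r c2 v4 by (subst sum.insert) auto
    moreover have "?v k = e * f 0" using 4 v2 by simp
    moreover have "l * (e * f 0) = e * ((real r - 1) * c + f 1)" using junction by simp
    ultimately show ?thesis unfolding eq by (simp add: algebra_simps)
  next
    case 5
    have N: "N = insert (r + s) {r+s+1..<?n} - {k}" using 5 r k by (auto simp: N_def double_kite_def)
    have "sum ?v N = e * f 0 + (real r - 1) * (e * c) - e * c"
      unfolding N using 5 k c2 v2 r by (subst sum_diff1) (auto simp: kite_vec_def)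
    also have "\<dots> = l * (e * c)" unfolding clique[symmetric] by (simp add: algebra_simps)
    finally show ?thesis unfolding eq using 5 r by (simp add: kite_vec_def)
  qed
qed

lemma kite_vec_root:
  assumes r: "2 \<le> r"
    and sym: "\<And>j. j \<le> Suc s \<Longrightarrow> f (Suc s - j) = e * f j" and e: "e * e = 1"
    and path: "\<And>j. 1 \<le> j \<Longrightarrow> j \<le> s \<Longrightarrow> l * f j = f (j - 1) + f (j + 1)"
    and clique: "(l - real r + 2) * c = f 0"
    and junction: "l * f 0 = (real r - 1) * c + f 1"
    and c: "c \<noteq> 0"
  shows "poly (char_poly (adjacency_matrix (double_kite r s))) l = 0"
  unfolding double_kite_adjacency char_poly_root_iff
proof (intro exI conjI allI impI)
  show "0 < 2 * r + s" "kite_vec r s e c f 0 \<noteq> 0" using r c by (auto simp: kite_vec_def)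
qed (rule kite_vec_eigen[OF assms(1-6)])

text \<open>
  Two vertices of a clique away from the junction are adjacent and have the same other neighbours, so
  the difference of their unit vectors is an eigenvector.
\<close>
lemma double_kite_root_minus_1:
  assumes r: "3 \<le> r"
  shows "poly (char_poly (adjacency_matrix (double_kite r s))) (-1) = 0"
  unfolding double_kite_adjacency char_poly_root_iff
proof (intro exI[of _ "\<lambda>k. if k = 0 then 1 else if k = 1 then -1 else 0"] conjI allI impI)
  show "\<exists>k<2 * r + s. (if k = 0 then 1 else if k = 1 then -1 else (0::real)) \<noteq> 0"
    using r by (intro exI[of _ 0]) auto
  fix k assume k: "k < 2 * r + s"
  let ?u = "\<lambda>k. if k = 0 then 1 else if k = 1 then -1 else (0::real)"
  have "(\<Sum>j<2 * r + s. adj (double_kite r s) k j * ?u j) = (\<Sum>j\<in>{0, 1}. adj (double_kite r s) k j * ?u j)"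
    by (rule sum.mono_neutral_right) (use r in auto)
  also have "\<dots> = adj (double_kite r s) k 0 - adj (double_kite r s) k 1" by simp
  also have "\<dots> = -1 * ?u k" using r by (auto simp: adj_def double_kite_def)
  finally show "(\<Sum>j<2 * r + s. adj (double_kite r s) k j * ?u j) = -1 * ?u k" .
qed

lemma double_kite_connected:
  assumes r: "2 \<le> r"
  shows "connected_graph_on (2 * r + s) (double_kite r s)"
proof -
  let ?G = "double_kite r s" and ?n = "2 * r + s"
  have "parcs ?G \<subseteq> {..<?n} \<times> {..<?n}" using r by (auto simp: double_kite_def)
  then have fin: "finite (parcs ?G)" by (rule finite_subset) auto
  have pg: "pair_graph ?G"
  proof
    show "symmetric (with_proj ?G)"
      by (auto simp: symmetric_def sym_def double_kite_def)
  qed (use fin r in \<open>auto simp: double_kite_def\<close>)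
  interpret pair_graph ?G by (rule pg)
  have le: "j < ?n \<longrightarrow> i \<rightarrow>\<^sup>*\<^bsub>with_proj ?G\<^esub> j" if "i \<le> j" for i j
    using that
  proof (induction j rule: dec_induct)
    case base
    show ?case by (simp add: reachable_refl)
  next
    case (step j)
    show ?case
    proof
      assume j: "Suc j < ?n"
      then have "i \<rightarrow>\<^sup>*\<^bsub>with_proj ?G\<^esub> j" using step.IH by simp
      then show "i \<rightarrow>\<^sup>*\<^bsub>with_proj ?G\<^esub> Suc j"
        by (rule reachable_adj_trans) (use double_kite_consecutive[OF r j] in simp)
    qed
  qed
  have all: "i \<rightarrow>\<^sup>*\<^bsub>with_proj ?G\<^esub> j" if "i < ?n" "j < ?n" for i j
  proof (cases "i \<le> j")
    case True
    then show ?thesis using le that by blast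
  next
    case False
    then have "j \<rightarrow>\<^sup>*\<^bsub>with_proj ?G\<^esub> i" using le[of j i] that by simp
    then show ?thesis by (rule symmetric_reachable[OF sym_arcs])
  qed
  have verts: "pverts (mk_symmetric (with_proj ?G)) = {..<?n}" by (simp add: mk_symmetric_def)
  have "Digraph_Component.connected (with_proj ?G)"
    unfolding Digraph_Component.connected_def
  proof (rule strongly_connectedI)
    show "verts (with_proj (mk_symmetric (with_proj ?G))) \<noteq> {}"
      using r by (simp add: verts lessThan_empty_iff)
    fix i j assume "i \<in> verts (with_proj (mk_symmetric (with_proj ?G)))"
      "j \<in> verts (with_proj (mk_symmetric (with_proj ?G)))"
    then have "i < ?n" "j < ?n" by (simp_all add: verts)
    then show "i \<rightarrow>\<^sup>*\<^bsub>with_proj (mk_symmetric (with_proj ?G))\<^esub> j"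
      by (intro reachable_mk_symmetricI all)
  qed
  then show ?thesis using pg by (simp add: connected_graph_on_def)
qed

section \<open>Eigenvectors that grow and decay along the path\<close>

text \<open>
  Up to the factor \<open>x\<close> to the power \<open>(s + 1) / 2\<close>, these are twice the hyperbolic cosine (\<open>e = 1\<close>) and
  sine (\<open>e = - 1\<close>) centred at the middle of the path. The factor keeps all exponents natural.
\<close>
definition profile :: "nat \<Rightarrow> real \<Rightarrow> real \<Rightarrow> nat \<Rightarrow> real" where
  "profile s e x j = x ^ (Suc s - j) + e * x ^ j"

lemma profile_reflect: "e * e = 1 \<Longrightarrow> j \<le> Suc s \<Longrightarrow> profile s e x (Suc s - j) = e * profile s e x j"
  by (simp add: profile_def algebra_simps flip: mult.assoc)

lemma profile_recurrence:
  assumes "x \<noteq> 0" "1 \<le> j" "j \<le> s"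
  shows "(x + 1 / x) * profile s e x j = profile s e x (j - 1) + profile s e x (j + 1)"
proof -
  obtain i where i: "j = Suc i" using assms by (cases j) auto
  obtain k where k: "s = j + k" using assms(3) le_Suc_ex by blast
  show ?thesis using assms(1) by (simp add: i k profile_def Suc_diff_le field_simps)
qed

text \<open>
  The eigenvalue equation at a junction, for the eigenvalue \<open>x + 1 / x\<close>, after the common value at the
  other clique vertices has been eliminated with the equation there.
\<close>
definition junction_eq :: "nat \<Rightarrow> nat \<Rightarrow> real \<Rightarrow> real \<Rightarrow> bool" where
  "junction_eq r s e x \<longleftrightarrow>
     (x + 1 / x - (real r - 1) / (x + 1 / x - real r + 2)) * profile s e x 0 = profile s e x 1"

text \<open>
  The intermediate value theorem on the interval from \<open>r - 2\<close> to \<open>r\<close>: at the left end the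
  coefficient of \<open>profile s e x 0\<close> is at most \<open>0\<close>, at the right end it is at least \<open>1\<close>, while
  \<open>0 \<le> profile s e x 1 \<le> profile s e x 0\<close>. For \<open>e = - 1\<close> the profile vanishes identically at \<open>x = 1\<close>, which is the
  reason for asking \<open>4 \<le> r\<close> in this case. The last two conclusions bound the ratio of the
  entries at the junction and in the rest of the clique.
\<close>
lemma junction_eq_solution:
  assumes r: "3 \<le> r" and e: "e = 1 \<or> e = -1 \<and> 1 \<le> s \<and> 4 \<le> r"
  obtains x where "1 < x" "real r - 2 \<le> x" "x \<le> real r" "junction_eq r s e x"
    "1 \<le> x + 1 / x - real r + 2" "x + 1 / x - real r + 2 \<le> 3"
proof -
  define h where "h x = x + 1 / x - (real r - 1) / (x + 1 / x - real r + 2)" for x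
  define F where "F x = h x * profile s e x 0 - profile s e x 1" for x
  have t_pos: "0 < x + 1 / x - real r + 2" if "real r - 2 \<le> x" for x
  proof -
    have "0 < 1 / x" using that r by simp
    then show ?thesis using that by linarith
  qed
  have pr0: "0 \<le> profile s e x 0" "0 \<le> profile s e x 1" "profile s e x 1 \<le> profile s e x 0" if x: "1 \<le> x" for x
  proof -
    have 1: "1 \<le> x ^ s" using x by simp
    show "0 \<le> profile s e x 0" using e one_le_power[OF x, of "Suc s"] by (auto simp: profile_def)
    have "x \<le> x ^ s" if "1 \<le> s" using power_increasing[OF that x] by simp
    then show "0 \<le> profile s e x 1" using e x by (auto simp: profile_def)
    have "0 \<le> (x ^ s - 1) * (x - 1)" "0 \<le> (x ^ s + 1) * (x - 1)" using 1 x by auto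
    then show "profile s e x 1 \<le> profile s e x 0" using e by (auto simp: profile_def algebra_simps)
  qed
  have low: "F (real r - 2) \<le> 0"
  proof -
    define x where "x = real r - 2"
    have x: "1 \<le> x" "real r = x + 2" using r by (auto simp: x_def)
    have "h x = 1 / x - x\<^sup>2" using x by (simp add: h_def field_simps power2_eq_square)
    moreover have "1 / x \<le> 1" "1 \<le> x\<^sup>2" using x by auto
    ultimately have "h x \<le> 0" by simp
    then have "h x * profile s e x 0 \<le> 0" using pr0(1)[OF x(1)] by (simp add: mult_le_0_iff)
    then show ?thesis using pr0(2)[OF x(1)] by (simp add: F_def x_def)
  qed
  have high: "0 \<le> F (real r)"
  proof -
    have x: "1 \<le> real r" using r by simp
    have "(real r - 1) / (real r + 1 / real r - real r + 2) \<le> (real r - 1) / 2"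
      by (rule divide_left_mono) (use x in \<open>auto intro!: add_pos_pos mult_pos_pos\<close>)
    moreover have "0 \<le> 1 / real r" by simp
    ultimately have "real r - (real r - 1) / 2 \<le> h (real r)" unfolding h_def by linarith
    moreover have "1 \<le> real r - (real r - 1) / 2" using x by (simp add: field_simps)
    ultimately have "1 \<le> h (real r)" by (rule order_trans[rotated])
    then have "1 * profile s e (real r) 0 \<le> h (real r) * profile s e (real r) 0"
      using pr0(1)[OF x] by (intro mult_right_mono)
    then show ?thesis using pr0(3)[OF x] by (simp add: F_def)
  qed
  have "continuous_on {real r - 2..real r} F"
    unfolding F_def h_def profile_def using r t_pos
    by (intro continuous_intros) (auto simp: less_le[of 0])
  then obtain x where x: "real r - 2 \<le> x" "x \<le> real r" "F x = 0"
    using IVT'[of F "real r - 2" 0 "real r"] low high by auto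
  have x1: "1 \<le> x" using x r by simp
  have "x \<noteq> 1"
  proof
    assume "x = 1"
    then have "r = 3" using x r by linarith
    then have "e = 1" using e by auto
    then show False using x(3) \<open>x = 1\<close> \<open>r = 3\<close> by (simp add: F_def h_def profile_def)
  qed
  then have x1': "1 < x" using x1 by simp
  have pos: "0 < profile s e x 0" using e one_less_power[OF x1', of "Suc s"] by (auto simp: profile_def intro: add_pos_pos)
  define t where "t = x + 1 / x - real r + 2"
  have t0: "0 < t" using t_pos[OF x(1)] by (simp add: t_def)
  have "h x * profile s e x 0 = profile s e x 1" using x(3) by (simp add: F_def)
  then have "0 \<le> h x" using pos pr0(2)[OF x1] by (metis zero_le_mult_iff not_le)
  then have "(real r - 1) / t \<le> t + (real r - 2)" unfolding h_def t_def by simp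
  then have ge: "real r - 1 \<le> (t + (real r - 2)) * t" using t0 by (simp add: pos_divide_le_eq)
  have t1: "1 \<le> t"
  proof (rule ccontr)
    assume "\<not> 1 \<le> t"
    then have "(t + (real r - 2)) * t < (1 + (real r - 2)) * 1"
      using t0 r by (intro mult_strict_mono) auto
    then show False using ge by simp
  qed
  have "1 / x \<le> 1" using x1 by simp
  then have t3: "t \<le> 3" using x(2) unfolding t_def by linarith
  show ?thesis
    by (rule that[OF x1' x(1,2)]) (use x(3) t1 t3 in \<open>auto simp: junction_eq_def F_def h_def t_def\<close>)
qed

lemma profile_eigen:
  assumes r: "2 \<le> r" and e: "e * e = 1" and x: "0 < x" and t: "1 \<le> x + 1 / x - real r + 2"
    and J: "junction_eq r s e x"
  defines "c \<equiv> profile s e x 0 / (x + 1 / x - real r + 2)"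
  shows "k < 2 * r + s \<Longrightarrow> (\<Sum>j<2 * r + s. adj (double_kite r s) k j * kite_vec r s e c (profile s e x) j)
     = (x + 1 / x) * kite_vec r s e c (profile s e x) k"
    and "profile s e x 0 \<noteq> 0 \<Longrightarrow> poly (char_poly (adjacency_matrix (double_kite r s))) (x + 1 / x) = 0"
proof -
  have cl: "(x + 1 / x - real r + 2) * c = profile s e x 0" using t by (simp add: c_def)
  have ju: "(x + 1 / x) * profile s e x 0 = (real r - 1) * c + profile s e x 1"
    using J by (simp add: junction_eq_def c_def left_diff_distrib)
  show "k < 2 * r + s \<Longrightarrow> (\<Sum>j<2 * r + s. adj (double_kite r s) k j * kite_vec r s e c (profile s e x) j)
     = (x + 1 / x) * kite_vec r s e c (profile s e x) k"
    by (rule kite_vec_eigen[OF r profile_reflect[OF e] e profile_recurrence cl ju]) (use x in auto)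
  show "profile s e x 0 \<noteq> 0 \<Longrightarrow> poly (char_poly (adjacency_matrix (double_kite r s))) (x + 1 / x) = 0"
    by (rule kite_vec_root[OF r profile_reflect[OF e] e profile_recurrence cl ju]) (use x t in \<open>auto simp: c_def\<close>)
qed

text \<open>
  The even eigenvector is positive. Its largest entry is of order \<open>x\<close> to the power \<open>s + 1\<close>, and
  neighbouring entries on the path have a product of at least the power \<open>s + 2\<close>, attained in the middle
  up to a constant, which leaves the ratio \<open>1 / x\<^sup>s\<close>.
\<close>
lemma spectral_gap_ge_large_clique:
  assumes r: "3 \<le> r" and n: "n = 2 * r + s"
  shows "1 / (72 * (real n)\<^sup>2 * real r ^ s) \<le> spectral_gap (double_kite r s)"
proof -
  obtain x where x: "1 < x" "real r - 2 \<le> x" "x \<le> real r" and J: "junction_eq r s 1 x"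
    and t: "1 \<le> x + 1 / x - real r + 2" "x + 1 / x - real r + 2 \<le> 3"
    using junction_eq_solution[of r 1 s] r by blast
  define f where "f = profile s 1 x"
  define c where "c = f 0 / (x + 1 / x - real r + 2)"
  define v where "v = kite_vec r s 1 c f"
  define X where "X = x ^ Suc s"
  have X: "1 \<le> X" unfolding X_def using x by (intro one_le_power) simp
  have f0: "f 0 = X + 1" by (simp add: f_def profile_def X_def)
  have f_pos: "0 < f j" for j using x by (simp add: f_def profile_def add_pos_pos)
  have f_le: "f j \<le> 2 * X" if "j \<le> Suc s" for j
  proof -
    have "x ^ (Suc s - j) \<le> X" "x ^ j \<le> X"
      unfolding X_def using x that by (intro power_increasing; simp)+
    then show ?thesis by (simp add: f_def profile_def)
  qed
  \<comment> \<open>The growing part of one entry times the decaying part of the other does not depend on \<open>j\<close>.\<close>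
  have f_edge: "x * X \<le> f j * f (Suc j)" if "j \<le> s" for j
  proof -
    have "x * X = x ^ (Suc s - j) * x ^ Suc j"
      using that by (simp add: X_def flip: power_add power_Suc)
    also have "\<dots> \<le> f j * f (Suc j)"
      using x by (intro mult_mono) (auto simp: f_def profile_def intro!: add_nonneg_nonneg)
    finally show ?thesis .
  qed
  have xX: "x * X \<le> X * X"
    using x X power_increasing[of 1 "Suc s" x] by (intro mult_right_mono) (auto simp: X_def)
  have c_le: "c \<le> f 0" using t f_pos[of 0] by (simp add: c_def pos_divide_le_eq mult_le_cancel_left1)
  have c_ge: "f 0 / 3 \<le> c" unfolding c_def using t f_pos[of 0] by (intro divide_left_mono) auto
  have c_pos: "0 < c" using c_ge f_pos[of 0] by simp
  have cX: "X / 3 \<le> c" using c_ge f0 by simp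
  have cc: "x * X / 9 \<le> c * c"
  proof -
    have "x * X / 9 \<le> X / 3 * (X / 3)" using xX by simp
    also have "\<dots> \<le> c * c" using cX X c_pos by (intro mult_mono) auto
    finally show ?thesis .
  qed
  have cf: "x * X / 9 \<le> c * f 0"
    using cc mult_left_mono[OF c_le less_imp_le[OF c_pos]] by (rule order_trans)
  have fc: "x * X / 9 \<le> f 0 * c" using cf by (simp only: mult.commute)
  have v_pos: "0 < v k" for k using c_pos f_pos by (simp add: v_def kite_vec_def)
  have c2X: "c \<le> 2 * X" using c_le f_le[of 0] by simp
  have v_le: "v k \<le> 2 * X" if "k < n" for k
    using c2X f_le that r by (auto simp: v_def kite_vec_def)
  have v_edge: "x * X / 9 \<le> v k * v (Suc k)" if k: "Suc k < n" for k
  proof -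
    consider "Suc k < r - 1" | "Suc k = r - 1" | "r - 1 \<le> k" "k < r + s" | "k = r + s" | "r + s < k" by linarith
    then show ?thesis
    proof cases
      case 1 then show ?thesis using cc by (simp add: v_def kite_vec_def)
    next
      case 2
      moreover have "r - 1 \<le> r + s" by simp
      ultimately have "v k = c" "v (Suc k) = f 0" by (simp_all add: v_def kite_vec_def)
      then show ?thesis using cf by simp
    next
      case 3
      have "x * X / 9 \<le> x * X" using x X by simp
      also have "\<dots> \<le> f (k - (r - 1)) * f (Suc (k - (r - 1)))" by (rule f_edge) (use 3 r in auto)
      finally show ?thesis using 3 r by (simp add: v_def kite_vec_def Suc_diff_le)
    next
      case 4
      have "f (Suc s) = f 0" by (simp add: f_def profile_def)
      moreover have "r + s - (r - 1) = Suc s" "\<not> r + s < r - 1" using r by simp_all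
      ultimately have "v k = f 0" "v (Suc k) = c" using 4 by (simp_all add: v_def kite_vec_def)
      then show ?thesis using fc by simp
    next
      case 5 then show ?thesis using cc by (simp add: v_def kite_vec_def)
    qed
  qed
  have "(x * X / 9) / (2 * (2 * X)\<^sup>2 * (real n)\<^sup>2) \<le> spectral_gap (double_kite r s)"
  proof (rule spectral_gap_ge_if_positive_eigenvector[of r n s v _ _ "x + 1 / x" "-1"])
    show "0 < v k" "k < n \<Longrightarrow> v k \<le> 2 * X" "Suc k < n \<Longrightarrow> x * X / 9 \<le> v k * v (Suc k)" for k
      by (rule v_pos v_le v_edge; assumption?)+
    fix k assume "k < n"
    then show "(\<Sum>j<n. adj (double_kite r s) k j * v j) = (x + 1 / x) * v k"
      unfolding n v_def c_def f_def using r x t J by (intro profile_eigen(1)) auto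
  next
    show "poly (char_poly (adjacency_matrix (double_kite r s))) (-1) = 0"
      by (rule double_kite_root_minus_1[OF r])
    have "0 < 1 / x" using x by simp
    then show "-1 \<noteq> x + 1 / x" "0 < x + 1 / x" using x(1) by linarith+
    show "0 < x * X / 9" using x X by simp
  qed (use r n in auto)
  moreover have "(x * X / 9) / (2 * (2 * X)\<^sup>2 * (real n)\<^sup>2) = 1 / (72 * (real n)\<^sup>2 * x ^ s)"
    using x(1) by (simp add: X_def field_simps power2_eq_square)
  moreover have "1 / (72 * (real n)\<^sup>2 * real r ^ s) \<le> 1 / (72 * (real n)\<^sup>2 * x ^ s)"
    using x r n by (intro divide_left_mono mult_left_mono power_mono mult_pos_pos) auto
  ultimately show ?thesis by linarith
qed

text \<open>
  With \<open>h\<close> as in the proof, the eigenvalues \<open>l\<close> and \<open>l'\<close> of the even and the odd eigenvector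
  satisfy \<open>h l = 1 / x + \<epsilon>\<close> and \<open>h l' = 1 / y - \<epsilon>'\<close> with exponentially small \<open>\<epsilon>\<close> and \<open>\<epsilon>'\<close>. Since \<open>h\<close>
  has slope at least \<open>1\<close>, and \<open>1 / x \<le> 1 / y\<close> for the larger eigenvalue \<open>l\<close>, this bounds \<open>l - l'\<close>.
\<close>
lemma spectral_gap_le:
  assumes r: "4 \<le> r" and s: "1 \<le> s"
  shows "spectral_gap (double_kite r s) \<le> 3 / (real r - 2) ^ s"
proof -
  have r3: "3 \<le> r" using r by simp
  obtain x where x: "1 < x" "real r - 2 \<le> x" "x \<le> real r" and Jx: "junction_eq r s 1 x"
    and tx: "1 \<le> x + 1 / x - real r + 2" and "x + 1 / x - real r + 2 \<le> 3"
    using junction_eq_solution[of r 1 s] r3 by blast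
  obtain y where y: "1 < y" "real r - 2 \<le> y" "y \<le> real r" and Jy: "junction_eq r s (-1) y"
    and ty: "1 \<le> y + 1 / y - real r + 2" and "y + 1 / y - real r + 2 \<le> 3"
    using junction_eq_solution[of r "-1" s] r3 r s by blast
  define l where "l = x + 1 / x"
  define l' where "l' = y + 1 / y"
  define h where "h z = z - (real r - 1) / (z - real r + 2)" for z
  have fx: "0 < profile s 1 x 0" using x by (simp add: profile_def add_pos_pos)
  have fy: "0 < profile s (-1) y 0" using one_less_power[OF y(1), of "Suc s"] by (simp add: profile_def)
  have root: "poly (char_poly (adjacency_matrix (double_kite r s))) l = 0"
    unfolding l_def by (rule profile_eigen(2)[OF _ _ _ tx Jx]) (use x r fx in auto)
  have root': "poly (char_poly (adjacency_matrix (double_kite r s))) l' = 0"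
    unfolding l'_def by (rule profile_eigen(2)[OF _ _ _ ty Jy]) (use y r fy in auto)
  define c where "c = profile s 1 x 0 / (x + 1 / x - real r + 2)"
  define v where "v = kite_vec r s 1 c (profile s 1 x)"
  have "0 < c" unfolding c_def using fx tx by (intro divide_pos_pos) auto
  then have v_pos: "0 < v k" for k
    using x by (simp add: v_def kite_vec_def profile_def add_pos_pos)
  have top: "m \<le> l" if "poly (char_poly (adjacency_matrix (double_kite r s))) m = 0" for m
  proof (rule perron_bound[where v = v])
    show "poly (char_poly (mat (2 * r + s) (2 * r + s) (\<lambda>(i, j). adj (double_kite r s) i j))) m = 0"
      using that by (simp only: double_kite_adjacency)
    show "(\<Sum>j<2 * r + s. adj (double_kite r s) k j * v j) = l * v k" if "k < 2 * r + s" for k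
      unfolding v_def c_def l_def using that r x tx Jx by (intro profile_eigen(1)) auto
  qed (auto simp: v_pos adj_def)
  have xs1: "0 < x ^ s" "1 < x ^ Suc s" using x by (auto intro: one_less_power simp del: power_Suc)
  have ys1: "2 \<le> y ^ Suc s" 
  proof -
    have "2 \<le> y" using y r by simp
    also have "y \<le> y ^ Suc s" using power_increasing[of 1 "Suc s" y] y by simp
    finally show ?thesis .
  qed
  have hx: "h l * (x ^ Suc s + 1) = x ^ s + x"
    using Jx by (simp add: junction_eq_def h_def l_def profile_def)
  have hy: "h l' * (y ^ Suc s - 1) = y ^ s - y"
    using Jy by (simp add: junction_eq_def h_def l'_def profile_def)
  have split: "(D / z + B) / D = 1 / z + B / D" "(D / z - B) / D = 1 / z - B / D"
    if "D \<noteq> 0" for B D z :: real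
    using that by (simp_all add: add_divide_distrib diff_divide_distrib)
  have hx': "h l = 1 / x + (x - 1 / x) / (x ^ Suc s + 1)"
  proof -
    have "h l = (x ^ s + x) / (x ^ Suc s + 1)" using hx xs1 by (simp only: eq_divide_eq) simp
    also have "x ^ s + x = (x ^ Suc s + 1) / x + (x - 1 / x)" using x by (simp add: field_simps)
    also have "\<dots> / (x ^ Suc s + 1) = 1 / x + (x - 1 / x) / (x ^ Suc s + 1)"
      using xs1 by (intro split) simp
    finally show ?thesis .
  qed
  have hy': "h l' = 1 / y - (y - 1 / y) / (y ^ Suc s - 1)"
  proof -
    have "h l' = (y ^ s - y) / (y ^ Suc s - 1)" using hy ys1 by (simp only: eq_divide_eq) simp
    also have "y ^ s - y = (y ^ Suc s - 1) / y - (y - 1 / y)" using y by (simp add: field_simps)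
    also have "\<dots> / (y ^ Suc s - 1) = 1 / y - (y - 1 / y) / (y ^ Suc s - 1)"
      using ys1 by (intro split) simp
    finally show ?thesis .
  qed
  have px: "0 < x - 1 / x" "x - 1 / x \<le> x" and py: "0 < y - 1 / y" "y - 1 / y \<le> y"
    using x y by (auto simp: field_simps less_1_mult)
  have "(x - 1 / x) / (x ^ Suc s + 1) \<le> x / x ^ Suc s"
    using px x xs1 by (intro frac_le) auto
  then have hx_le: "h l \<le> 1 / x + 1 / x ^ s" using hx' x by simp
  have "(y - 1 / y) / (y ^ Suc s - 1) \<le> y / (y ^ Suc s / 2)"
    using py y ys1 by (intro frac_le) auto
  then have hy_ge: "1 / y - 2 / y ^ s \<le> h l'" using hy' y by simp
  have "l' \<le> l" by (rule top[OF root'])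
  moreover have "l' \<noteq> l"
  proof
    assume eq: "l' = l"
    have "x = y"
    proof -
      have "x * x * y + y = y * y * x + x" using eq x y by (simp add: l_def l'_def field_simps)
      then have "(x - y) * (x * y - 1) = 0" by (simp add: algebra_simps)
      moreover have "1 < x * y" using x y by (simp add: less_1_mult)
      ultimately show ?thesis by simp
    qed
    moreover have "1 / x < h l" using hx' px xs1 by simp
    moreover have "h l' < 1 / y" using hy' py ys1 by simp
    ultimately show False using eq by simp
  qed
  ultimately have less: "l' < l" by simp
  have "y \<le> x"
  proof (rule ccontr)
    assume "\<not> y \<le> x"
    then have "0 \<le> (y - x) * (x * y - 1)" using x y by (intro mult_nonneg_nonneg) (auto simp: less_1_mult less_imp_le)
    then have "x + 1 / x \<le> y + 1 / y" using x y by (simp add: field_simps)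
    then show False using less by (simp add: l_def l'_def)
  qed
  then have inv: "1 / x \<le> 1 / y" using y by (intro divide_left_mono) auto
  have "(real r - 1) / (l - real r + 2) \<le> (real r - 1) / (l' - real r + 2)"
    using less ty r by (intro divide_left_mono) (auto simp: l'_def)
  then have "l - l' \<le> h l - h l'" by (simp add: h_def)
  also have "\<dots> \<le> 1 / x ^ s + 2 / y ^ s" using hx_le hy_ge inv by linarith
  also have "\<dots> \<le> 1 / (real r - 2) ^ s + 2 / (real r - 2) ^ s"
    using x y r by (intro add_mono divide_left_mono power_mono mult_pos_pos) auto
  also have "\<dots> = 3 / (real r - 2) ^ s" by (simp add: field_simps)
  finally have "l - l' \<le> 3 / (real r - 2) ^ s" .
  moreover have "spectral_gap (double_kite r s) \<le> l - l'"
    unfolding spectral_gap_def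
    using graph_eigenvalue_1_eq[OF root top double_kite_char_poly_nonzero]
      graph_eigenvalue_2_ge[OF root root' less double_kite_char_poly_nonzero] by simp
  ultimately show ?thesis by linarith
qed

section \<open>Cliques of size two and the general lower bound\<close>

text \<open>
  For \<open>r = 2\<close> the double kite is a path on \<open>n\<close> vertices, whose largest eigenvalue is below \<open>2\<close> and not of
  the form \<open>x + 1 / x\<close> with real \<open>x\<close>. The eigenvectors are sines with frequencies that are multiples
  of \<open>pi / (n + 1)\<close>; the first frequency gives the positive eigenvector and the second another root.
\<close>
lemma spectral_gap_ge_path_graph:
  assumes n: "n = 4 + s"
  shows "1 / (8 * real n ^ 4) \<le> spectral_gap (double_kite 2 s)"
proof -
  define th where "th = pi / (real n + 1)"
  have th: "0 < th" "(real n + 1) * th = pi"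
    by (auto simp: th_def add_pos_pos add_eq_0_iff)
  have th3: "th \<le> pi / 3"
    unfolding th_def using n by (intro divide_left_mono) auto
  define S where "S a k = sin (real k * a)" for a k
  have S_rec: "2 * cos a * S a (Suc k) = S a k + S a (Suc (Suc k))" for a k
    using sin_add[of "real (Suc k) * a" a] sin_diff[of "real (Suc k) * a" a]
    by (simp add: S_def algebra_simps)
  define sn where "sn = S th"
  have sn_refl: "sn (n + 1 - k) = sn k" if "k \<le> n + 1" for k
  proof -
    have "real (n + 1 - k) * th = pi - real k * th"
      using that th(2) by (simp add: of_nat_diff algebra_simps)
    then show ?thesis by (simp add: sn_def S_def)
  qed
  have sn_le: "sn k \<le> 1" for k by (simp add: sn_def S_def)
  have s1: "sin th \<le> sn k" if k: "1 \<le> k" "k \<le> n" for k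
  proof -
    have main: "sin th \<le> sn k" if "1 \<le> k" "real k * th \<le> pi / 2" for k
      unfolding sn_def S_def
    proof (rule sin_monotone_2pi_le)
      show "th \<le> real k * th" using that th by (simp add: mult_le_cancel_right1)
      show "- (pi / 2) \<le> th" using th pi_gt_zero by linarith
    qed (use that in simp)
    show ?thesis
    proof (cases "real k * th \<le> pi / 2")
      case True then show ?thesis using main k by blast
    next
      case False
      have "real (n + 1 - k) * th = pi - real k * th"
        using k th(2) by (simp add: of_nat_diff algebra_simps)
      then have "sin th \<le> sn (n + 1 - k)" using False k by (intro main) auto
      then show ?thesis using sn_refl k by simp
    qed
  qed
  have s0: "1 / (2 * real n) \<le> sin th"
  proof -
    obtain z where z: "0 < z" "z < th" "sin th - sin 0 = (th - 0) * cos z"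
      using MVT2[of 0 th sin cos] th(1) by (auto intro: derivative_intros)
    \<comment> \<open>The bound \<open>th \<le> pi / 3\<close> keeps the slope of the sine at least \<open>1 / 2\<close>.\<close>
    have "cos (pi / 3) \<le> cos z"
      using z th th3 pi_gt_zero by (intro cos_monotone_0_pi_le) linarith+
    then have "th * (1 / 2) \<le> sin th" using z th by (simp add: cos_60)
    moreover have "1 / (2 * real n) \<le> th * (1 / 2)"
    proof -
      have "1 / (2 * real n) \<le> 2 / ((real n + 1) * 2)" using n by (simp add: field_simps)
      also have "\<dots> \<le> pi / ((real n + 1) * 2)" using pi_ge_two by (intro divide_right_mono) auto
      finally show ?thesis by (simp add: th_def)
    qed
    ultimately show ?thesis by linarith
  qed
  define v where "v = kite_vec 2 s 1 (sn 1) (\<lambda>j. sn (j + 2))"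
  have v_eq: "v k = sn (k + 1)" if "k < n" for k
  proof -
    have "sn n = sn 1" using sn_refl[of 1] n by simp
    moreover have "k = n - 1" if "\<not> k \<le> 2 + s" using that \<open>k < n\<close> n by simp
    ultimately show ?thesis using n by (auto simp: v_def kite_vec_def numeral_2_eq_2)
  qed
  have v_ge: "1 / (2 * real n) \<le> v k" if "k < n" for k
    using s0 s1[of "k + 1"] v_eq[OF that] that by simp
  have n1: "real n \<ge> 1" using n by simp
  have "(1 / (2 * real n))\<^sup>2 / (2 * 1\<^sup>2 * (real n)\<^sup>2) \<le> spectral_gap (double_kite 2 s)"
  proof (rule spectral_gap_ge_if_positive_eigenvector[of 2 n s v 1 _ "2 * cos th" "2 * cos (2 * th)"])
    show "n = 2 * 2 + s" using n by simp
    have pos: "0 < 1 / (2 * real n)" using n1 by simp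
    show "0 < v k" if "k < n" for k using v_ge[OF that] pos by linarith
    show "v k \<le> 1" if "k < n" for k using v_eq[OF that] sn_le by simp
    show "0 < (1 / (2 * real n))\<^sup>2" using pos by simp
    show "(1 / (2 * real n))\<^sup>2 \<le> v k * v (Suc k)" if "Suc k < n" for k
      unfolding power2_eq_square using v_ge[of k] v_ge[OF that] pos that by (intro mult_mono) linarith+
    show "(\<Sum>j<n. adj (double_kite 2 s) k j * v j) = 2 * cos th * v k" if "k < n" for k
    proof -
      have "(\<Sum>j<2 * 2 + s. adj (double_kite 2 s) k j * v j) = 2 * cos th * v k"
        unfolding v_def
      proof (rule kite_vec_eigen)
        show "sn (Suc s - j + 2) = 1 * sn (j + 2)" if "j \<le> Suc s" for j
        proof -
          have "Suc s - j + 2 = n + 1 - (j + 2)" using that n by simp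
          then show ?thesis using sn_refl[of "j + 2"] that n by simp
        qed
        show "2 * cos th * sn (j + 2) = sn (j - 1 + 2) + sn (j + 1 + 2)" if "1 \<le> j" for j
          using S_rec[of th "j + 1"] that by (simp add: sn_def)
        show "(2 * cos th - real 2 + 2) * sn 1 = sn (0 + 2)"
          using S_rec[of th 0] by (simp add: sn_def S_def)
        show "2 * cos th * sn (0 + 2) = (real 2 - 1) * sn 1 + sn (1 + 2)"
          using S_rec[of th 1] by (simp add: sn_def numeral_3_eq_3)
      qed (use that n in auto)
      then show ?thesis using n by simp
    qed
    show "0 < 2 * cos th" using th th3 pi_gt_zero by (intro mult_pos_pos cos_gt_zero) linarith+
    have "cos (2 * th) < cos th"
      using th th3 pi_gt_zero by (intro cos_monotone_0_pi) linarith+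
    then show "2 * cos (2 * th) \<noteq> 2 * cos th" by simp
    show "poly (char_poly (adjacency_matrix (double_kite 2 s))) (2 * cos (2 * th)) = 0"
    proof (rule kite_vec_root[where f = "\<lambda>j. S (2 * th) (j + 2)" and e = "-1" and c = "S (2 * th) 1"])
      show "S (2 * th) (Suc s - j + 2) = -1 * S (2 * th) (j + 2)" if "j \<le> Suc s" for j
      proof -
        have "real (Suc s - j + 2) * (2 * th) = 2 * pi - real (j + 2) * (2 * th)"
          using that n th(2) by (simp add: of_nat_diff algebra_simps)
        then show ?thesis by (simp add: S_def sin_diff)
      qed
      show "2 * cos (2 * th) * S (2 * th) (j + 2) = S (2 * th) (j - 1 + 2) + S (2 * th) (j + 1 + 2)"
        if "1 \<le> j" for j
        using S_rec[of "2 * th" "j + 1"] that by simp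
      show "(2 * cos (2 * th) - real 2 + 2) * S (2 * th) 1 = S (2 * th) (0 + 2)"
        using S_rec[of "2 * th" 0] by (simp add: S_def)
      show "2 * cos (2 * th) * S (2 * th) (0 + 2) = (real 2 - 1) * S (2 * th) 1 + S (2 * th) (1 + 2)"
        using S_rec[of "2 * th" 1] by (simp add: numeral_3_eq_3)
      have "0 < sin (2 * th)" using th th3 pi_gt_zero by (intro sin_gt_zero) linarith+
      then show "S (2 * th) 1 \<noteq> 0" by (simp add: S_def)
    qed auto
  qed simp
  also have "(1 / (2 * real n))\<^sup>2 / (2 * 1\<^sup>2 * (real n)\<^sup>2) = 1 / (8 * real n ^ 4)"
    by (simp add: field_simps flip: power_add)
  finally show ?thesis .
qed

lemma spectral_gap_ge:
  assumes r: "2 \<le> r" and n: "n = 2 * r + s"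
  shows "1 / (72 * real n ^ 4 * real r ^ s) \<le> spectral_gap (double_kite r s)"
proof (cases "r = 2")
  case True
  have n0: "0 < real n" using r n by simp
  have "(1::real) \<le> 2 ^ s" by simp
  then have "8 * real n ^ 4 * 1 \<le> 72 * real n ^ 4 * 2 ^ s" using n0 by (intro mult_mono) auto
  then have "1 / (72 * real n ^ 4 * real r ^ s) \<le> 1 / (8 * real n ^ 4)"
    using n0 True by (intro divide_left_mono) auto
  also have "\<dots> \<le> spectral_gap (double_kite r s)"
    using spectral_gap_ge_path_graph[of n s] n True by simp
  finally show ?thesis .
next
  case False
  have n1: "1 \<le> real n" using r n by simp
  have "72 * (real n)\<^sup>2 * real r ^ s \<le> 72 * real n ^ 4 * real r ^ s"
    using n1 power_increasing[of 2 4 "real n"] by (intro mult_right_mono mult_left_mono) auto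
  then have "1 / (72 * real n ^ 4 * real r ^ s) \<le> 1 / (72 * (real n)\<^sup>2 * real r ^ s)"
    using n1 r by (intro divide_left_mono) auto
  also have "\<dots> \<le> spectral_gap (double_kite r s)"
    by (rule spectral_gap_ge_large_clique[OF _ n]) (use r False in simp)
  finally show ?thesis .
qed

section \<open>Asymptotics of the optimal clique size\<close>

lemma sqrt_sub_one_le:
  fixes d :: real
  assumes "0 < d" "d - 1 - ln d \<le> e"
  shows "(sqrt d - 1)\<^sup>2 \<le> e"
proof -
  have "ln d = 2 * ln (sqrt d)" using assms(1) by (simp add: ln_sqrt)
  also have "\<dots> \<le> 2 * (sqrt d - 1)" using assms(1) ln_le_minus_one[of "sqrt d"] by simp
  finally show ?thesis using assms by (simp add: power2_diff)
qed

text \<open>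
  Near its minimum at \<open>1\<close>, the function \<open>d - 1 - ln d\<close> controls the distance of \<open>d\<close> to \<open>1\<close>, by the
  quadratic lower bound above.
\<close>
lemma tendsto_one_if_log_defect:
  fixes d e :: "nat \<Rightarrow> real"
  assumes "\<forall>\<^sub>F n in sequentially. 0 < d n \<and> d n - 1 - ln (d n) \<le> e n" and e: "e \<longlonglongrightarrow> 0"
  shows "d \<longlonglongrightarrow> 1"
proof -
  have "(\<lambda>n. (sqrt (d n) - 1)\<^sup>2) \<longlonglongrightarrow> 0"
  proof (rule tendsto_sandwich[OF _ _ tendsto_const e])
    show "\<forall>\<^sub>F n in sequentially. (sqrt (d n) - 1)\<^sup>2 \<le> e n"
      using assms(1) by eventually_elim (auto intro: sqrt_sub_one_le)
  qed auto
  then have "(\<lambda>n. sqrt ((sqrt (d n) - 1)\<^sup>2)) \<longlonglongrightarrow> sqrt 0" by (rule tendsto_real_sqrt)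
  then have "(\<lambda>n. sqrt (d n) - 1) \<longlonglongrightarrow> 0" by (simp add: tendsto_rabs_zero_iff)
  then have "(\<lambda>n. sqrt (d n)) \<longlonglongrightarrow> 1" by (simp add: LIM_zero_iff)
  then have "(\<lambda>n. (sqrt (d n))\<^sup>2) \<longlonglongrightarrow> 1\<^sup>2" by (rule tendsto_power)
  then have "(\<lambda>n. (sqrt (d n))\<^sup>2) \<longlonglongrightarrow> 1" by simp
  moreover have "\<forall>\<^sub>F n in sequentially. (sqrt (d n))\<^sup>2 = d n"
    using assms(1) by eventually_elim simp
  ultimately show ?thesis by (rule Lim_transform_eventually)
qed

text \<open>
  With \<open>c = 2 r ln n / n\<close> and \<open>L = ln n\<close>, the right hand side of \<open>B\<close> is \<open>n\<close> times
  \<open>(1 - c / L) (ln c + L - ln 2 - ln L)\<close>. The products of \<open>c / L\<close> with \<open>ln 2 + ln L\<close> need not be small, as \<open>c\<close> may be as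
  large as \<open>L\<close>; they are absorbed by passing from \<open>c\<close> to \<open>d = c (1 - a)\<close> with \<open>a\<close> tending to \<open>0\<close>.
  The product \<open>c ln c\<close> is at least \<open>- 1\<close>, so only a term \<open>1 / L\<close> remains.
\<close>
lemma clique_size_asymptotics:
  fixes r :: "nat \<Rightarrow> nat"
  assumes r: "\<forall>\<^sub>F n in sequentially. 2 \<le> r n \<and> 2 * r n \<le> n"
    and B: "\<forall>\<^sub>F n in sequentially. real n * ln n - real n * ln (ln n) - real n * ln 2 - real n - e n * real n
        \<le> (real n - 2 * real (r n)) * ln (real (r n))"
    and e: "e \<longlonglongrightarrow> 0"
  shows "(\<lambda>n. 2 * real (r n) * ln (real n) / real n) \<longlonglongrightarrow> 1"
proof -
  define c where "c n = 2 * real (r n) * ln (real n) / real n" for n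
  define a where "a n = (ln (ln (real n)) + ln 2) / ln (real n)" for n
  have a: "a \<longlonglongrightarrow> 0" unfolding a_def by real_asymp
  have a1: "\<forall>\<^sub>F n in sequentially. a n < 1" using a by (rule order_tendstoD) simp
  define d where "d n = c n * (1 - a n)" for n
  have "d \<longlonglongrightarrow> 1"
  proof (rule tendsto_one_if_log_defect)
    show "(\<lambda>n. e n + 1 / ln (real n) - ln (1 - a n)) \<longlonglongrightarrow> 0"
    proof -
      have "(\<lambda>n. ln (1 - a n)) \<longlonglongrightarrow> ln (1 - 0)" by (rule tendsto_ln[OF tendsto_diff[OF tendsto_const a]]) simp
      moreover have "(\<lambda>n::nat. 1 / ln (real n)) \<longlonglongrightarrow> 0" by real_asymp
      ultimately show ?thesis using tendsto_diff[OF tendsto_add[OF e]] by fastforce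
    qed
    have "\<forall>\<^sub>F n in sequentially. 3 \<le> n" by (rule eventually_ge_at_top)
    with r B a1 show "\<forall>\<^sub>F n in sequentially. 0 < d n \<and> d n - 1 - ln (d n) \<le> e n + 1 / ln (real n) - ln (1 - a n)"
    proof eventually_elim
      case (elim n)
      define L where "L = ln (real n)"
      have L: "0 < L" "0 < real n" using elim by (auto simp: L_def)
      have c0: "0 < c n" using elim L by (simp add: c_def L_def)
      have cL: "c n \<le> L"
      proof -
        have "2 * real (r n) * L / real n \<le> real n * L / real n"
          using elim L by (intro divide_right_mono mult_right_mono) auto
        then show ?thesis using L by (simp add: c_def L_def)
      qed
      have rn: "2 * real (r n) = c n * real n / L" using L by (simp add: c_def L_def)
      have r_eq: "real (r n) = c n * real n / (2 * L)" using rn by simp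
      have lnr: "ln (real (r n)) = ln (c n) + L - ln 2 - ln L"
        unfolding r_eq using c0 L by (simp add: ln_div ln_mult L_def)
      have pre: "real n * L - real n * ln L - real n * ln 2 - real n - e n * real n
        \<le> (real n - c n * real n / L) * (ln (c n) + L - ln 2 - ln L)"
        using elim(2) unfolding rn lnr L_def[symmetric] .
      have "real n * (L - ln L - ln 2 - 1 - e n) \<le> real n * ((1 - c n / L) * (ln (c n) + L - ln 2 - ln L))"
      proof -
        have "real n - c n * real n / L = real n * (1 - c n / L)" by (simp add: algebra_simps)
        moreover have "real n * L - real n * ln L - real n * ln 2 - real n - e n * real n
          = real n * (L - ln L - ln 2 - 1 - e n)" by (simp add: algebra_simps)
        ultimately show ?thesis using pre by (simp only: mult.assoc)
      qed
      then have "L - ln L - ln 2 - 1 - e n \<le> (1 - c n / L) * (ln (c n) + L - ln 2 - ln L)"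
        using L by simp
      also have "\<dots> = L - ln 2 - ln L + ln (c n) - c n * (1 - a n) - c n * ln (c n) / L"
        using L by (simp add: a_def L_def[symmetric] field_simps)
      finally have main: "c n * (1 - a n) - 1 - ln (c n) \<le> e n - c n * ln (c n) / L" by simp
      have "-1 \<le> c n * ln (c n)"
      proof -
        have "ln (1 / c n) \<le> 1 / c n - 1" using c0 by (intro ln_le_minus_one) simp
        then have "- ln (c n) \<le> 1 / c n" using c0 by (simp add: ln_div)
        then have "c n * (- ln (c n)) \<le> c n * (1 / c n)" using c0 by (intro mult_left_mono) auto
        then show ?thesis using c0 by simp
      qed
      then have "- 1 / L \<le> c n * ln (c n) / L" using L by (intro divide_right_mono) auto
      then have "c n * (1 - a n) - 1 - ln (c n) \<le> e n + 1 / L" using main by simp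
      moreover have "ln (d n) = ln (c n) + ln (1 - a n)"
        unfolding d_def using c0 elim by (simp add: ln_mult)
      moreover have "0 < d n" using c0 elim by (simp add: d_def)
      ultimately show ?case by (simp add: d_def L_def)
    qed
  qed
  then have "(\<lambda>n. d n / (1 - a n)) \<longlonglongrightarrow> 1 / (1 - 0)" by (intro tendsto_intros a) auto
  moreover have "\<forall>\<^sub>F n in sequentially. d n / (1 - a n) = c n"
    using a1 by eventually_elim (simp add: d_def)
  ultimately show ?thesis unfolding c_def by (simp add: tendsto_cong)
qed

text \<open>
  The subtracted terms \<open>ln 216\<close> and \<open>4 ln n\<close> are the loss in the comparison of the two bounds for the gap:
  \<open>216 = 3 * 72\<close>, and \<open>n\<close> to the fourth power comes from \<open>spectral_gap_ge\<close>.
\<close>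
lemma competitor_clique_size:
  fixes r0 :: "nat \<Rightarrow> nat"
  defines "r0 \<equiv> \<lambda>n. nat \<lfloor>real n / (2 * ln (real n))\<rfloor>"
  shows "\<exists>e. e \<longlonglongrightarrow> 0 \<and> (\<forall>\<^sub>F n in sequentially. 5 \<le> r0 n \<and> 2 * r0 n + 1 \<le> n \<and>
     real n * ln n - real n * ln (ln n) - real n * ln 2 - real n - e n * real n
        \<le> (real n - 2 * real (r0 n)) * ln (real (r0 n) - 2) - ln 216 - 4 * ln (real n))"
proof -
  \<comment> \<open>Rounding down and then subtracting \<open>2\<close> stays above \<open>y n - 3\<close>.\<close>
  define y where "y n = real n / (2 * ln (real n))" for n :: nat
  define e where "e n = (real n * ln n - real n * ln (ln n) + real n * ln (1 / 2) - real n
      - (real n - 2 * y n) * ln (y n - 3) + ln 216 + 4 * ln (real n)) / real n" for n :: nat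
  have e: "e \<longlonglongrightarrow> 0" unfolding e_def y_def by real_asymp
  have "\<forall>\<^sub>F n in sequentially. 6 \<le> y n" unfolding y_def by real_asymp
  moreover have "\<forall>\<^sub>F n in sequentially. 2 * y n + 1 \<le> real n" unfolding y_def by real_asymp
  moreover have "\<forall>\<^sub>F n in sequentially. 0 < n" by (rule eventually_gt_at_top)
  ultimately have "\<forall>\<^sub>F n in sequentially. 5 \<le> r0 n \<and> 2 * r0 n + 1 \<le> n \<and>
     real n * ln n - real n * ln (ln n) - real n * ln 2 - real n - e n * real n
        \<le> (real n - 2 * real (r0 n)) * ln (real (r0 n) - 2) - ln 216 - 4 * ln (real n)"
  proof eventually_elim
    case (elim n)
    have ub: "real (r0 n) \<le> y n" and lb: "y n - 1 \<le> real (r0 n)"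
      using elim(1) unfolding r0_def y_def by linarith+
    have "real 5 \<le> real (r0 n)" using lb elim by linarith
    then have r5: "5 \<le> r0 n" by (simp only: of_nat_le_iff)
    have "real (2 * r0 n + 1) \<le> real n" using ub elim by simp
    then have rn: "2 * r0 n + 1 \<le> n" by (simp only: of_nat_le_iff)
    have "(real n - 2 * y n) * ln (y n - 3) \<le> (real n - 2 * real (r0 n)) * ln (real (r0 n) - 2)"
      using ub lb elim by (intro mult_mono) auto
    then show ?case using r5 rn elim(3) by (simp add: e_def ln_div)
  qed
  then show ?thesis using e by blast
qed

theorem mainTheorem2:
  fixes r s :: "nat \<Rightarrow> nat"
  assumes "\<forall>n\<ge>4. r n \<ge> 2 \<and> 2 * r n + s n = n"
    and "\<forall>\<^sub>F n in sequentially.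
           is_arg_min spectral_gap (connected_graph_on n) (double_kite (r n) (s n))"
  shows "(\<lambda>n. real (r n)) \<sim>[sequentially] (\<lambda>n. real n / (2 * ln (real n)))
       \<and> (\<lambda>n. 2 * real (r n) * ln (real n) / real n) \<longlonglongrightarrow> 1"
proof -
  define r0 where "r0 n = nat \<lfloor>real n / (2 * ln (real n))\<rfloor>" for n
  obtain e where e: "e \<longlonglongrightarrow> 0"
    and comp: "\<forall>\<^sub>F n in sequentially. 5 \<le> r0 n \<and> 2 * r0 n + 1 \<le> n \<and>
     real n * ln n - real n * ln (ln n) - real n * ln 2 - real n - e n * real n
        \<le> (real n - 2 * real (r0 n)) * ln (real (r0 n) - 2) - ln 216 - 4 * ln (real n)"
    using competitor_clique_size unfolding r0_def by blast
  have n4: "\<forall>\<^sub>F n in sequentially. 4 \<le> n" by (rule eventually_ge_at_top)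
  have "(\<lambda>n. 2 * real (r n) * ln (real n) / real n) \<longlonglongrightarrow> 1"
  proof (rule clique_size_asymptotics[OF _ _ e])
    show "\<forall>\<^sub>F n in sequentially. 2 \<le> r n \<and> 2 * r n \<le> n"
      using n4 by eventually_elim (use assms(1) le_add1 in metis)
    show "\<forall>\<^sub>F n in sequentially. real n * ln n - real n * ln (ln n) - real n * ln 2 - real n - e n * real n
        \<le> (real n - 2 * real (r n)) * ln (real (r n))"
      using n4 comp assms(2)
    proof eventually_elim
      case (elim n)
      define s0 where "s0 = n - 2 * r0 n"
      have r: "2 \<le> r n" "n = 2 * r n + s n" using assms(1) elim(1) by auto
      have s0: "n = 2 * r0 n + s0" "1 \<le> s0" using elim(2) by (auto simp: s0_def)
      have "connected_graph_on n (double_kite (r0 n) s0)"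
        using double_kite_connected[of "r0 n" s0] elim(2) s0(1) by simp
      then have "spectral_gap (double_kite (r n) (s n)) \<le> spectral_gap (double_kite (r0 n) s0)"
        using elim(3) by (auto simp: is_arg_min_def not_less)
      also have "\<dots> \<le> 3 / (real (r0 n) - 2) ^ s0" by (rule spectral_gap_le) (use elim(2) s0 in auto)
      finally have "1 / (72 * real n ^ 4 * real (r n) ^ s n) \<le> 3 / (real (r0 n) - 2) ^ s0"
        using spectral_gap_ge[OF r] by linarith
      moreover have pos: "0 < real n" "0 < real (r n)" "0 < real (r0 n) - 2" using r elim by auto
      ultimately have "(real (r0 n) - 2) ^ s0 \<le> 216 * real n ^ 4 * real (r n) ^ s n"
        by (simp add: field_simps)
      then have "ln ((real (r0 n) - 2) ^ s0) \<le> ln (216 * real n ^ 4 * real (r n) ^ s n)"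
        using pos by (intro ln_mono) auto
      then have "real s0 * ln (real (r0 n) - 2) \<le> ln 216 + 4 * ln (real n) + real (s n) * ln (real (r n))"
        using pos by (simp add: ln_mult ln_realpow)
      moreover have "real s0 = real n - 2 * real (r0 n)"
        using arg_cong[OF s0(1), of real] by simp
      moreover have "real (s n) = real n - 2 * real (r n)"
        using arg_cong[OF r(2), of real] by simp
      ultimately show ?case using elim(2) by simp
    qed
  qed
  moreover from this have "(\<lambda>n. real (r n)) \<sim>[sequentially] (\<lambda>n. real n / (2 * ln (real n)))"
    by (intro asymp_equivI') (simp add: mult_ac)
  ultimately show ?thesis by blast
qed

end
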